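(* Let $n\ge1$ and $\mathbb{M}\in\mathbb{D}_{++}^{n}$. Let $\mathcal{L}_{++}^{n}$ be the Cholesky manifold endowed with the Diagonal Bures–Wasserstein Metric $g=g^{\mathbb{M}\text{-DBW}}$ (defined in the context). Let $L,K\in\mathcal{L}_{++}^{n}$, $X,Y\in T_L\mathcal{L}_{++}^{n}$, and let $L_1,\dots,L_N\in\mathcal{L}_{++}^{n}$ with weights $w_1,\dots,w_N>0$, $\sum_{i=1}^N w_i=1$. Then: 1. (metric) $g_L(X,Y)=\langle\lfloor X\rfloor,\lfloor Y\rfloor\rangle+\frac14\langle\mathbb{L}^{-1}\mathbb{X},\mathbb{M}^{-1}\mathbb{Y}\rangle$; 2. (geodesic) the geodesic starting at $L$ with initial velocity $X$ is $\gamma_{(L,X)}(t)=\lfloor L\rfloor+t\lfloor X\rfloor+\mathbb{L}\left(I+\frac t2\mathbb{L}^{-1}\mathbb{X}\right)^{2}$, locally defined for $t\in\{t\in\mathbb{R}\mid\mathbb{L}+\frac t2\mathbb{X}\in\mathbb{D}_{++}^{n}\}$; 3. (Riemannian logarithm) $\operatorname{Log}_L(K)=\lfloor K\rfloor-\lfloor L\rfloor+2\mathbb{L}\left[(\mathbb{L}^{-1}\mathbb{K})^{1/2}-I\right]$; 4. (parallel transport along the geodesic connecting $L$ and $K$) $\operatorname{PT}_{L\to K}(X)=\lfloor X\rfloor+(\mathbb{L}^{-1}\mathbb{K})^{1/2}\mathbb{X}$; 5. (geodesic distance) $\operatorname{d}^2(L,K)=\|\lfloor K\rfloor-\lfloor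 L\rfloor\|_{\mathrm F}^2+\left\|\mathbb{M}^{-1/2}\left(\mathbb{K}^{1/2}-\mathbb{L}^{1/2}\right)\right\|_{\mathrm F}^2$; 6. (weighted Fréchet mean) $\operatorname{WFM}(\{w_i\},\{L_i\})=\sum_i w_i\lfloor L_i\rfloor+\left(\sum_i w_i\mathbb{L}_i^{1/2}\right)^{2}$.
   Context: $\mathcal{L}_{++}^{n}$ (the Cholesky manifold) is the set of real $n\times n$ lower triangular matrices with positive diagonal entries, an open submanifold of the Euclidean space $\mathcal{L}^n$ of lower triangular matrices; so $T_L\mathcal{L}_{++}^{n}\cong\mathcal{L}^n$. $\mathbb{D}_{++}^{n}$ is the set of $n\times n$ diagonal matrices with positive diagonal entries. For a square matrix $A$, $\lfloor A\rfloor$ is its strictly lower triangular part, and the blackboard-bold letter $\mathbb{A}$ denotes the diagonal matrix with the diagonal entries of $A$ (so $\mathbb{L},\mathbb{K},\mathbb{X},\mathbb{Y},\mathbb{L}_i$ come from $L,K,X,Y,L_i$). Powers of positive diagonal matrices are taken entrywise on the diagonal. $\langle\cdot,\cdot\rangle$ and $\|\cdot\|_{\mathrm F}$ are the Frobenius inner product and norm. For $m>0$, the generalized Bures–Wasserstein metric on $\mathbb{R}_{++}=(0,\infty)$ (viewed as $1\times1$ SPD matrices) is $g^{m\text{-BW}}_p(v,w)=\frac12\mathcal{L}_{p,m}(v)\,w$, where $\mathcal{L}_{p,m}(v)$ is the solution of $m\,\mathcal{L}_{p,m}(v)\,p+p\,\mathcal{L}_{p,m}(v)\,m=v$. The Diagonal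 Bures–Wasserstein Metric ($\mathbb{M}$-DBWM) $g^{\mathbb{M}\text{-DBW}}$ on $\mathcal{L}_{++}^{n}$ is the product metric of the standard Euclidean metric on strictly lower triangular matrices and the metrics $g^{\mathbb{M}_{ii}\text{-BW}}$ on the diagonal entries: $g_L(X,Y)=\langle\lfloor X\rfloor,\lfloor Y\rfloor\rangle+\sum_{i=1}^n g^{\mathbb{M}_{ii}\text{-BW}}_{L_{ii}}(X_{ii},Y_{ii})$. $\operatorname{WFM}(\{w_i\},\{L_i\})$ is the minimizer over $P\in\mathcal{L}_{++}^{n}$ of $\sum_i w_i\operatorname{d}^2(P,L_i)$, with $\operatorname{d}$ the geodesic distance of $g$. *)

theory Defs
  imports "HOL-Analysis.Analysis"
begin

section \<open>Riemannian geometry on an open subset of a linear space\<close>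

text \<open>
  A manifold is given by a linear subspace \<open>V\<close> of a Euclidean space together with a set
  \<open>S \<subseteq> V\<close> that is open in \<open>V\<close>.  All tangent spaces are identified with \<open>V\<close>, the inclusion is a
  global chart, and a Riemannian metric is a map \<open>g\<close> with \<open>g p u v\<close> the inner product
  of \<open>u, v \<in> V\<close> at \<open>p \<in> S\<close>.
\<close>

definition metric_deriv ::
  "('a::real_vector \<Rightarrow> 'a \<Rightarrow> 'a \<Rightarrow> real) \<Rightarrow> 'a \<Rightarrow> 'a \<Rightarrow> 'a \<Rightarrow> 'a \<Rightarrow> real" where
  "metric_deriv g p u v w = deriv (\<lambda>s. g (p + s *\<^sub>R u) v w) 0"

text \<open>
  The Levi-Civita connection in the global chart is \<open>\<nabla>\<^sub>X Y = D\<^sub>X Y + \<Gamma>(X, Y)\<close>; by the Koszul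
  formula for constant fields, \<open>g(\<Gamma>(u, v), w) = (D\<^sub>u g(v, w) + D\<^sub>v g(u, w) - D\<^sub>w g(u, v)) / 2\<close>,
  which is the usual coordinate formula for the Christoffel symbols.
\<close>

definition christoffel ::
  "'a::real_vector set \<Rightarrow> ('a \<Rightarrow> 'a \<Rightarrow> 'a \<Rightarrow> real) \<Rightarrow> 'a \<Rightarrow> 'a \<Rightarrow> 'a \<Rightarrow> 'a" where
  "christoffel V g p u v =
     (THE z. z \<in> V \<and> (\<forall>w\<in>V. g p z w =
        (metric_deriv g p u v w + metric_deriv g p v u w - metric_deriv g p w u v) / 2))"

text \<open>
  The condition \<open>W' + \<Gamma>(\<gamma>', W) = 0\<close> along \<open>\<gamma>\<close>.  Derivatives are taken within the interval
  \<open>T\<close>, so they are one-sided at endpoints belonging to \<open>T\<close>.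
\<close>

definition parallel_field_on ::
  "'a::real_normed_vector set \<Rightarrow> ('a \<Rightarrow> 'a \<Rightarrow> 'a \<Rightarrow> real) \<Rightarrow> real set
     \<Rightarrow> (real \<Rightarrow> 'a) \<Rightarrow> (real \<Rightarrow> 'a) \<Rightarrow> bool" where
  "parallel_field_on V g T \<gamma> W \<longleftrightarrow>
     (\<exists>\<gamma>'. \<forall>t\<in>T. (\<gamma> has_vector_derivative \<gamma>' t) (at t within T) \<and> W t \<in> V \<and>
        (W has_vector_derivative - christoffel V g (\<gamma> t) (\<gamma>' t) (W t)) (at t within T))"

definition geodesic_on ::
  "'a::real_normed_vector set \<Rightarrow> 'a set \<Rightarrow> ('a \<Rightarrow> 'a \<Rightarrow> 'a \<Rightarrow> real) \<Rightarrow> real set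
     \<Rightarrow> (real \<Rightarrow> 'a) \<Rightarrow> bool" where
  "geodesic_on V S g T \<gamma> \<longleftrightarrow> is_interval T \<and> (\<forall>t\<in>T. \<gamma> t \<in> S) \<and>
     (\<exists>\<gamma>'. (\<forall>t\<in>T. (\<gamma> has_vector_derivative \<gamma>' t) (at t within T)) \<and>
        parallel_field_on V g T \<gamma> \<gamma>')"

definition geodesic_from ::
  "'a::real_normed_vector set \<Rightarrow> 'a set \<Rightarrow> ('a \<Rightarrow> 'a \<Rightarrow> 'a \<Rightarrow> real) \<Rightarrow> 'a \<Rightarrow> 'a
     \<Rightarrow> real set \<Rightarrow> (real \<Rightarrow> 'a) \<Rightarrow> bool" where
  "geodesic_from V S g p v T \<gamma> \<longleftrightarrow> geodesic_on V S g T \<gamma> \<and> 0 \<in> T \<and> \<gamma> 0 = p \<and>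
     (\<gamma> has_vector_derivative v) (at 0 within T)"

definition maximal_geodesic_from ::
  "'a::real_normed_vector set \<Rightarrow> 'a set \<Rightarrow> ('a \<Rightarrow> 'a \<Rightarrow> 'a \<Rightarrow> real) \<Rightarrow> 'a \<Rightarrow> 'a
     \<Rightarrow> real set \<Rightarrow> (real \<Rightarrow> 'a) \<Rightarrow> bool" where
  "maximal_geodesic_from V S g p v T \<gamma> \<longleftrightarrow> open T \<and> geodesic_from V S g p v T \<gamma> \<and>
     (\<forall>U c. open U \<and> geodesic_from V S g p v U c \<longrightarrow> U \<subseteq> T \<and> (\<forall>t\<in>U. c t = \<gamma> t))"

definition exp_domain ::
  "'a::real_normed_vector set \<Rightarrow> 'a set \<Rightarrow> ('a \<Rightarrow> 'a \<Rightarrow> 'a \<Rightarrow> real) \<Rightarrow> 'a \<Rightarrow> 'a set" where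
  "exp_domain V S g p = {v \<in> V. \<exists>\<gamma>. geodesic_from V S g p v {0..1} \<gamma>}"

definition riem_exp ::
  "'a::real_normed_vector set \<Rightarrow> 'a set \<Rightarrow> ('a \<Rightarrow> 'a \<Rightarrow> 'a \<Rightarrow> real) \<Rightarrow> 'a \<Rightarrow> 'a \<Rightarrow> 'a" where
  "riem_exp V S g p v = (THE q. \<exists>\<gamma>. geodesic_from V S g p v {0..1} \<gamma> \<and> \<gamma> 1 = q)"

text \<open>
  The logarithm inverts the exponential map on its whole domain; this is meaningful when the
  preimage of the point \<open>q\<close> is a single vector.
\<close>

definition riem_log ::
  "'a::real_normed_vector set \<Rightarrow> 'a set \<Rightarrow> ('a \<Rightarrow> 'a \<Rightarrow> 'a \<Rightarrow> real) \<Rightarrow> 'a \<Rightarrow> 'a \<Rightarrow> 'a" where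
  "riem_log V S g p q = (THE v. v \<in> exp_domain V S g p \<and> riem_exp V S g p v = q)"

definition geodesic_joining ::
  "'a::real_normed_vector set \<Rightarrow> 'a set \<Rightarrow> ('a \<Rightarrow> 'a \<Rightarrow> 'a \<Rightarrow> real) \<Rightarrow> 'a \<Rightarrow> 'a
     \<Rightarrow> (real \<Rightarrow> 'a) \<Rightarrow> bool" where
  "geodesic_joining V S g p q \<gamma> \<longleftrightarrow> geodesic_on V S g {0..1} \<gamma> \<and> \<gamma> 0 = p \<and> \<gamma> 1 = q"

definition transports_to ::
  "'a::real_normed_vector set \<Rightarrow> ('a \<Rightarrow> 'a \<Rightarrow> 'a \<Rightarrow> real) \<Rightarrow> (real \<Rightarrow> 'a) \<Rightarrow> 'a \<Rightarrow> 'a \<Rightarrow> bool" where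
  "transports_to V g \<gamma> v w \<longleftrightarrow> (\<exists>W. parallel_field_on V g {0..1} \<gamma> W \<and> W 0 = v \<and> W 1 = w)"

definition parallel_transport ::
  "'a::real_normed_vector set \<Rightarrow> ('a \<Rightarrow> 'a \<Rightarrow> 'a \<Rightarrow> real) \<Rightarrow> (real \<Rightarrow> 'a) \<Rightarrow> 'a \<Rightarrow> 'a" where
  "parallel_transport V g \<gamma> v = (THE w. transports_to V g \<gamma> v w)"

text \<open>
  \<^const>\<open>valid_path\<close> means piecewise continuously differentiable on \<open>[0, 1]\<close>.  It does not bound
  the speed near the break points, hence the explicit requirement that the length integral exists.
\<close>

definition has_riem_length ::
  "('a::real_normed_vector \<Rightarrow> 'a \<Rightarrow> 'a \<Rightarrow> real) \<Rightarrow> (real \<Rightarrow> 'a) \<Rightarrow> real \<Rightarrow> bool" where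
  "has_riem_length g \<gamma> l \<longleftrightarrow>
     ((\<lambda>t. sqrt (g (\<gamma> t) (vector_derivative \<gamma> (at t)) (vector_derivative \<gamma> (at t))))
        has_integral l) {0..1}"

definition geodesic_dist ::
  "'a::real_normed_vector set \<Rightarrow> ('a \<Rightarrow> 'a \<Rightarrow> 'a \<Rightarrow> real) \<Rightarrow> 'a \<Rightarrow> 'a \<Rightarrow> real" where
  "geodesic_dist S g p q =
     Inf {l. \<exists>\<gamma>. valid_path \<gamma> \<and> path_image \<gamma> \<subseteq> S \<and> pathstart \<gamma> = p \<and> pathfinish \<gamma> = q \<and>
        has_riem_length g \<gamma> l}"

definition is_frechet_mean ::
  "'a::real_normed_vector set \<Rightarrow> ('a \<Rightarrow> 'a \<Rightarrow> 'a \<Rightarrow> real) \<Rightarrow> 'i set \<Rightarrow> ('i \<Rightarrow> real)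
     \<Rightarrow> ('i \<Rightarrow> 'a) \<Rightarrow> 'a \<Rightarrow> bool" where
  "is_frechet_mean S g I w x =
     is_arg_min (\<lambda>p. \<Sum>i\<in>I. w i * (geodesic_dist S g p (x i))\<^sup>2) (\<lambda>p. p \<in> S)"

definition frechet_mean ::
  "'a::real_normed_vector set \<Rightarrow> ('a \<Rightarrow> 'a \<Rightarrow> 'a \<Rightarrow> real) \<Rightarrow> 'i set \<Rightarrow> ('i \<Rightarrow> real)
     \<Rightarrow> ('i \<Rightarrow> 'a) \<Rightarrow> 'a" where
  "frechet_mean S g I w x = (THE p. is_frechet_mean S g I w x p)"


section \<open>The Cholesky manifold\<close>

text \<open>
  Rows and columns are indexed by an arbitrary finite linearly ordered type.  On
  \<^typ>\<open>real^'n^'n\<close> the operations \<^const>\<open>inner\<close> and \<^const>\<open>norm\<close> are the Frobenius ones.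
\<close>

type_synonym 'n sq_mat = "real^'n^'n"

definition lower_tri :: "'n::{finite,linorder} sq_mat set" where
  "lower_tri = {A. \<forall>i j. i < j \<longrightarrow> A $ i $ j = 0}"

definition cholesky :: "'n::{finite,linorder} sq_mat set" where
  "cholesky = {A \<in> lower_tri. \<forall>i. 0 < A $ i $ i}"

definition pos_diag :: "'n::finite sq_mat set" where
  "pos_diag = {A. (\<forall>i j. i \<noteq> j \<longrightarrow> A $ i $ j = 0) \<and> (\<forall>i. 0 < A $ i $ i)}"

definition strict_lower :: "'n::{finite,linorder} sq_mat \<Rightarrow> 'n sq_mat" where
  "strict_lower A = (\<chi> i j. if j < i then A $ i $ j else 0)"

definition diag_part :: "'n::finite sq_mat \<Rightarrow> 'n sq_mat" where
  "diag_part A = (\<chi> i j. if i = j then A $ i $ i else 0)"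

text \<open>Entrywise real powers of the diagonal, intended for positive diagonal matrices.\<close>

definition diag_powr :: "'n::finite sq_mat \<Rightarrow> real \<Rightarrow> 'n sq_mat" where
  "diag_powr A r = (\<chi> i j. if i = j then (A $ i $ i) powr r else 0)"

text \<open>The power operation of \<^typ>\<open>real^'n^'n\<close> is componentwise, so squares use the matrix product.\<close>

definition mat_square :: "'n::finite sq_mat \<Rightarrow> 'n sq_mat" where
  "mat_square A = A ** A"

definition bw_lyapunov :: "real \<Rightarrow> real \<Rightarrow> real \<Rightarrow> real" where
  "bw_lyapunov m p v = (THE l. m * l * p + p * l * m = v)"

definition bw_metric :: "real \<Rightarrow> real \<Rightarrow> real \<Rightarrow> real \<Rightarrow> real" where
  "bw_metric m p v w = 1/2 * bw_lyapunov m p v * w"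

definition dbw_metric ::
  "'n::{finite,linorder} sq_mat \<Rightarrow> 'n sq_mat \<Rightarrow> 'n sq_mat \<Rightarrow> 'n sq_mat \<Rightarrow> real" where
  "dbw_metric M L X Y = strict_lower X \<bullet> strict_lower Y +
     (\<Sum>i\<in>UNIV. bw_metric (M $ i $ i) (L $ i $ i) (X $ i $ i) (Y $ i $ i))"

end

theory Submission
  imports Defs
begin

text \<open>
  The chart replacing each diagonal entry \<open>p\<close> by \<open>sqrt (p / m)\<close>, with \<open>m\<close> the corresponding entry
  of \<open>M\<close>, pulls the Frobenius inner product back to the diagonal Bures--Wasserstein metric, because
  \<open>(d sqrt (p / m))\<^sup>2 = dp\<^sup>2 / (4 m p)\<close>.  The metric is therefore flat: along any curve \<open>\<gamma>\<close> a parallel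
  field \<open>W\<close> has constant off-diagonal entries and constant ratios \<open>W\<^sub>i\<^sub>i / sqrt \<gamma>\<^sub>i\<^sub>i\<close>, and geodesics
  are straight lines in the chart.  The image of the chart is convex, so the distance is the
  Frobenius distance of the images and the Frechet mean is the preimage of their barycenter.
\<close>

section \<open>The metric as a pullback of the Frobenius inner product\<close>

text \<open>The connection is defined through the inclusion chart, so the Christoffel symbols are
  computed there; the resulting equations decouple into scalar ones, entry by entry. Uniqueness
  comes from first integrals, quantities with zero derivative on an interval, and existence from
  differentiating explicit solutions, so no general theorem on differential equations enters.
  \<open>M\<close> rescales the metric of each diagonal factor by a constant and cancels from the
  Christoffel symbols; hence geodesics, logarithm, transport and mean do not involve it, while
  metric and distance do. The metric is not complete: on the diagonal the chart image is the open
  positive orthant, and a geodesic ends when a chart coordinate reaches 0. The closed formula, a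
  square, continues past that time, and each squared equation has a second, negative root.
  Positivity of the root \<open>1 + t * v / (2 * p)\<close> is therefore tracked separately.\<close>

lemma has_vector_derivative_matrix_iff:
  fixes f :: "real \<Rightarrow> real^'n^'m"
  shows "(f has_vector_derivative f') (at a within S) \<longleftrightarrow>
    (\<forall>i j. ((\<lambda>x. f x $ i $ j) has_real_derivative f' $ i $ j) (at a within S))"
  unfolding has_vector_derivative_def has_derivative_componentwise_within[of f]
    has_field_derivative_def
  by (simp add: Basis_vec_def inner_axis mult_commute_abs)

lemma matrix_mult_diag_left:
  fixes D :: "real^'n^'n" and A :: "real^'m^'n"
  assumes "\<And>i j. i \<noteq> j \<Longrightarrow> D $ i $ j = 0"
  shows "(D ** A) $ i $ j = D $ i $ i * A $ i $ j"
proof -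
  have "(D ** A) $ i $ j = (\<Sum>k\<in>UNIV. if k = i then D $ i $ i * A $ i $ j else 0)"
    unfolding matrix_matrix_mult_def vec_lambda_beta
    by (rule sum.cong) (use assms[of i] in force)+
  then show ?thesis by simp
qed

lemma matrix_inv_diag:
  fixes D :: "real^'n^'n"
  assumes "D \<in> pos_diag"
  shows "matrix_inv D $ i $ j = (if i = j then 1 / D $ i $ i else 0)"
proof -
  let ?E = "(\<chi> i j. if i = j then 1 / D $ i $ i else 0) :: real^'n^'n"
  have D: "i \<noteq> j \<Longrightarrow> D $ i $ j = 0" "0 < D $ i $ i" for i j
    using assms by (auto simp: pos_diag_def)
  have nz: "D $ i $ i \<noteq> 0" for i using D(2)[of i] by simp
  have 1: "D ** ?E = mat 1"
    by (auto simp: vec_eq_iff matrix_mult_diag_left D mat_def nz)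
  then have 2: "?E ** D = mat 1" by (simp add: matrix_left_right_inverse)
  \<comment> \<open>\<open>matrix_inv\<close> is a choice operator: the witness \<open>?E\<close>
    guarantees that the chosen matrix is an inverse, and associativity then identifies the
    two.\<close>
  have "matrix_inv D ** D = mat 1"
    unfolding matrix_inv_def by (rule someI2[where a = ?E]) (use 1 2 in auto)
  then have "matrix_inv D = ?E"
    using 1 matrix_mul_assoc[of "matrix_inv D" D ?E] by (simp only: matrix_mul_lid matrix_mul_rid)
  then show ?thesis by simp
qed

lemma norm_matrix_squared:
  fixes A :: "real^'n^'m"
  shows "(norm A)\<^sup>2 = (\<Sum>i\<in>UNIV. \<Sum>j\<in>UNIV. (A $ i $ j)\<^sup>2)"
  by (simp only: power2_norm_eq_inner inner_vec_def) (simp add: power2_eq_square)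

lemma sum_diag_strict_lower:
  fixes a :: "'n::{finite,linorder} \<Rightarrow> real"
  shows "(\<Sum>i\<in>UNIV. \<Sum>j\<in>UNIV. if i = j then a i else if j < i then b i j else 0)
    = (\<Sum>i\<in>UNIV. a i) + (\<Sum>i\<in>UNIV. \<Sum>j\<in>UNIV. if j < i then b i j else 0)"
proof -
  have "(if i = j then a i else if j < i then b i j else 0)
      = (if i = j then a i else 0) + (if j < i then b i j else 0)" for i j
    by auto
  then show ?thesis by (simp add: sum.distrib)
qed

lemma strict_lower_inner:
  "strict_lower X \<bullet> strict_lower Y =
     (\<Sum>i\<in>UNIV. \<Sum>j\<in>UNIV. if j < i then X $ i $ j * Y $ i $ j else 0)"
  by (auto simp: strict_lower_def inner_vec_def intro!: sum.cong)

text \<open>For scalars the Lyapunov equation is \<open>2 * m * p * l = v\<close>; the further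
  factor \<open>1/2\<close> of the metric produces the 4.\<close>

lemma bw_metric_eq:
  assumes "m \<noteq> 0" "p \<noteq> 0"
  shows "bw_metric m p v w = v * w / (4 * m * p)"
proof -
  have "bw_lyapunov m p v = v / (2 * m * p)"
    unfolding bw_lyapunov_def
  proof (rule the_equality)
    show "m * (v / (2 * m * p)) * p + p * (v / (2 * m * p)) * m = v"
      using assms by (simp add: field_simps)
  next
    fix l assume "m * l * p + p * l * m = v"
    then show "l = v / (2 * m * p)" using assms by (simp add: field_simps)
  qed
  then show ?thesis by (simp add: bw_metric_def)
qed

lemma choleskyD:
  assumes "p \<in> cholesky"
  shows "0 < p $ i $ i" "i < j \<Longrightarrow> p $ i $ j = 0" "p $ i $ i \<noteq> 0"
proof -
  show *: "0 < p $ i $ i" "i < j \<Longrightarrow> p $ i $ j = 0"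
    using assms by (auto simp: cholesky_def lower_tri_def)
  from *(1) show "p $ i $ i \<noteq> 0" by simp
qed

lemma pos_diagD:
  assumes "M \<in> pos_diag"
  shows "0 < M $ i $ i" "i \<noteq> j \<Longrightarrow> M $ i $ j = 0" "M $ i $ i \<noteq> 0"
proof -
  show *: "0 < M $ i $ i" "i \<noteq> j \<Longrightarrow> M $ i $ j = 0"
    using assms by (auto simp: pos_diag_def)
  from *(1) show "M $ i $ i \<noteq> 0" by simp
qed

lemma dbw_metric_eq:
  assumes "M \<in> pos_diag" "p \<in> cholesky"
  shows "dbw_metric M p u v = strict_lower u \<bullet> strict_lower v +
    (\<Sum>i\<in>UNIV. u $ i $ i * v $ i $ i / (4 * M $ i $ i * p $ i $ i))"
  unfolding dbw_metric_def
  by (simp add: bw_metric_eq pos_diagD[OF assms(1)] choleskyD[OF assms(2)])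

section \<open>The chart and its differential\<close>

definition dbw_coords :: "'n::{finite,linorder} sq_mat \<Rightarrow> 'n sq_mat \<Rightarrow> 'n sq_mat" where
  "dbw_coords M p = (\<chi> i j. if i = j then sqrt (p $ i $ i / M $ i $ i)
     else if j < i then p $ i $ j else 0)"

text \<open>The differential of \<open>dbw_coords M\<close> at \<open>p\<close>: the chain rule
  gives the factor \<open>1 / (2 * m * sqrt (p / m))\<close>, and
  \<open>m * sqrt (p / m) = sqrt (m * p)\<close>.\<close>

definition dbw_coords_deriv ::
  "'n::{finite,linorder} sq_mat \<Rightarrow> 'n sq_mat \<Rightarrow> 'n sq_mat \<Rightarrow> 'n sq_mat" where
  "dbw_coords_deriv M p u = (\<chi> i j. if i = j then u $ i $ i / (2 * sqrt (M $ i $ i * p $ i $ i))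
     else if j < i then u $ i $ j else 0)"

text \<open>Valid for all matrices \<open>u\<close> and \<open>v\<close>, since both sides ignore
  the entries above the diagonal. The length integrand is thus nonnegative even where the vector
  derivative of a path is unspecified.\<close>

lemma dbw_metric_pullback:
  assumes "M \<in> pos_diag" "p \<in> cholesky"
  shows "dbw_metric M p u v = dbw_coords_deriv M p u \<bullet> dbw_coords_deriv M p v"
proof -
  have *: "u $ i $ i / (2 * sqrt (M $ i $ i * p $ i $ i)) *
        (v $ i $ i / (2 * sqrt (M $ i $ i * p $ i $ i)))
      = u $ i $ i * v $ i $ i / (4 * M $ i $ i * p $ i $ i)" for i
  proof -
    have "(2 * sqrt (M $ i $ i * p $ i $ i)) * (2 * sqrt (M $ i $ i * p $ i $ i))
        = 4 * M $ i $ i * p $ i $ i"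
      using pos_diagD(1)[OF assms(1), of i] choleskyD(1)[OF assms(2), of i] by simp
    then show ?thesis by (simp only: times_divide_times_eq)
  qed
  have "dbw_coords_deriv M p u \<bullet> dbw_coords_deriv M p v =
     (\<Sum>i\<in>UNIV. \<Sum>j\<in>UNIV. if i = j then u $ i $ i * v $ i $ i / (4 * M $ i $ i * p $ i $ i)
        else if j < i then u $ i $ j * v $ i $ j else 0)"
    unfolding dbw_coords_deriv_def inner_vec_def
    by (intro sum.cong refl) (simp add: *[symmetric])
  then show ?thesis
    by (simp add: dbw_metric_eq[OF assms] strict_lower_inner sum_diag_strict_lower)
qed

lemma dbw_coords_deriv_has_vector_derivative:
  assumes M: "M \<in> pos_diag" and p: "\<gamma> t \<in> cholesky"
    and d: "(\<gamma> has_vector_derivative v) (at t within T)"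
  shows "((\<lambda>t. dbw_coords M (\<gamma> t)) has_vector_derivative dbw_coords_deriv M (\<gamma> t) v) (at t within T)"
proof -
  have d': "((\<lambda>x. \<gamma> x $ i $ j) has_real_derivative v $ i $ j) (at t within T)" for i j
    using d by (simp add: has_vector_derivative_matrix_iff)
  have "((\<lambda>x. sqrt (\<gamma> x $ i $ i / M $ i $ i)) has_real_derivative
      v $ i $ i / (2 * sqrt (M $ i $ i * \<gamma> t $ i $ i))) (at t within T)" for i
  proof -
    let ?m = "M $ i $ i" and ?g = "\<gamma> t $ i $ i"
    have pos: "0 < ?m" "0 < ?g" using M p by (auto simp: pos_diagD choleskyD)
    have "((\<lambda>x. sqrt (\<gamma> x $ i $ i / ?m)) has_real_derivative
        inverse (sqrt (?g / ?m)) / 2 * (v $ i $ i / ?m)) (at t within T)"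
      using pos by (intro DERIV_chain2[OF DERIV_real_sqrt] DERIV_cdivide d') auto
    moreover have "inverse (sqrt (?g / ?m)) / 2 * (v $ i $ i / ?m)
        = v $ i $ i / (2 * sqrt (?m * ?g))"
    proof -
      have "sqrt (?g / ?m) * ?m = sqrt (?m * ?g)"
        using pos by (simp add: real_sqrt_divide real_sqrt_mult field_simps)
      then show ?thesis using pos by (simp add: field_simps)
    qed
    ultimately show ?thesis by simp
  qed
  then show ?thesis
    using d' by (auto simp: has_vector_derivative_matrix_iff dbw_coords_def dbw_coords_deriv_def)
qed

lemma dbw_coords_deriv_diff:
  "dbw_coords_deriv M p (u - v) = dbw_coords_deriv M p u - dbw_coords_deriv M p v"
  by (auto simp: dbw_coords_deriv_def vec_eq_iff diff_divide_distrib)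

text \<open>Nondegeneracy of the metric on tangent vectors. Membership in \<open>lower_tri\<close>
  takes care of the entries above the diagonal, which the differential sends to 0.\<close>

lemma dbw_coords_deriv_eq_0:
  assumes "M \<in> pos_diag" "p \<in> cholesky" "u \<in> lower_tri" "dbw_coords_deriv M p u = 0"
  shows "u = 0"
proof -
  have "u $ i $ j = 0" for i j
  proof -
    have e: "dbw_coords_deriv M p u $ i $ j = 0" using assms(4) by simp
    show ?thesis
    proof (cases i j rule: linorder_cases)
      case less then show ?thesis using assms(3) by (auto simp: lower_tri_def)
    next
      case equal
      then show ?thesis
        using e pos_diagD[OF assms(1), of i] choleskyD[OF assms(2), of i]
        by (auto simp: dbw_coords_deriv_def)
    next
      case greater then show ?thesis using e by (auto simp: dbw_coords_deriv_def split: if_splits)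
    qed
  qed
  then show ?thesis by (simp add: vec_eq_iff)
qed

section \<open>Christoffel symbols\<close>

lemma metric_deriv_dbw:
  assumes M: "M \<in> pos_diag" and p: "p \<in> cholesky"
  shows "metric_deriv (dbw_metric M) p u v w =
    - (\<Sum>i\<in>UNIV. u $ i $ i * v $ i $ i * w $ i $ i / (4 * M $ i $ i * (p $ i $ i)\<^sup>2))"
  unfolding metric_deriv_def
proof (rule DERIV_imp_deriv)
  have "((\<lambda>s. bw_metric (M $ i $ i) ((p + s *\<^sub>R u) $ i $ i) (v $ i $ i) (w $ i $ i))
      has_real_derivative - (u $ i $ i * v $ i $ i * w $ i $ i / (4 * M $ i $ i * (p $ i $ i)\<^sup>2)))
      (at 0)" for i
  proof -
    let ?m = "M $ i $ i" and ?g = "p $ i $ i"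
    have pos: "0 < ?m" "0 < ?g" using M p by (auto simp: pos_diagD choleskyD)
    show ?thesis
    \<comment> \<open>The closed form of the scalar metric is used only where the moving diagonal
      entry is positive, which is an open condition on \<open>s\<close> satisfied at 0.\<close>
    proof (rule has_field_derivative_transform_within_open)
      show "((\<lambda>s. v $ i $ i * w $ i $ i / (4 * ?m * (?g + s * u $ i $ i))) has_real_derivative
          - (u $ i $ i * v $ i $ i * w $ i $ i / (4 * ?m * ?g\<^sup>2))) (at 0)"
        using pos by (auto intro!: derivative_eq_intros simp: field_simps power2_eq_square)
      show "open {s. 0 < ?g + s * u $ i $ i}"
        by (intro open_Collect_less continuous_intros)
      show "0 \<in> {s. 0 < ?g + s * u $ i $ i}" using pos by simp
      show "v $ i $ i * w $ i $ i / (4 * ?m * (?g + s * u $ i $ i)) =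
          bw_metric ?m ((p + s *\<^sub>R u) $ i $ i) (v $ i $ i) (w $ i $ i)"
        if "s \<in> {s. 0 < ?g + s * u $ i $ i}" for s
        using that pos by (simp add: bw_metric_eq)
    qed
  qed
  then have "((\<lambda>s. strict_lower v \<bullet> strict_lower w +
      (\<Sum>i\<in>UNIV. bw_metric (M $ i $ i) ((p + s *\<^sub>R u) $ i $ i) (v $ i $ i) (w $ i $ i)))
      has_real_derivative 0 + (\<Sum>i\<in>UNIV. - (u $ i $ i * v $ i $ i * w $ i $ i /
        (4 * M $ i $ i * (p $ i $ i)\<^sup>2)))) (at 0)"
    by (intro DERIV_add DERIV_const DERIV_sum)
  then show "((\<lambda>s. dbw_metric M (p + s *\<^sub>R u) v w) has_real_derivative
     - (\<Sum>i\<in>UNIV. u $ i $ i * v $ i $ i * w $ i $ i / (4 * M $ i $ i * (p $ i $ i)\<^sup>2))) (at 0)"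
    unfolding dbw_metric_def by (simp add: sum_negf)
qed

text \<open>Only the diagonal coefficients \<open>1 / (4 * m * p)\<close> vary with the point, so
  \<open>metric_deriv\<close> is totally symmetric in its three vectors and the Koszul expression
  collapses to half of one term. Dividing \<open>- 1 / (8 * m * p\<^sup>2)\<close> by the
  coefficient leaves \<open>- 1 / (2 * p)\<close>.\<close>

lemma christoffel_dbw:
  assumes M: "M \<in> pos_diag" and p: "p \<in> cholesky"
  shows "christoffel lower_tri (dbw_metric M) p u v =
    (\<chi> i j. if i = j then - (u $ i $ i * v $ i $ i / (2 * p $ i $ i)) else 0)"
    (is "_ = ?z")
  unfolding christoffel_def
proof (rule the_equality)
  have eq: "dbw_metric M p ?z w = (metric_deriv (dbw_metric M) p u v w
      + metric_deriv (dbw_metric M) p v u w - metric_deriv (dbw_metric M) p w u v) / 2" for w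
  proof -
    let ?S = "\<Sum>i\<in>UNIV. u $ i $ i * v $ i $ i * w $ i $ i / (4 * M $ i $ i * (p $ i $ i)\<^sup>2)"
    have "strict_lower ?z \<bullet> strict_lower w = 0"
      by (auto simp: strict_lower_inner intro!: sum.neutral)
    then have "dbw_metric M p ?z w =
        (\<Sum>i\<in>UNIV. - (u $ i $ i * v $ i $ i * w $ i $ i / (4 * M $ i $ i * (p $ i $ i)\<^sup>2)) / 2)"
      by (simp add: dbw_metric_eq[OF M p] power2_eq_square mult_ac)
    then have "dbw_metric M p ?z w = - ?S / 2"
      by (simp only: sum_divide_distrib[symmetric] sum_negf)
    moreover have "metric_deriv (dbw_metric M) p u v w = - ?S"
      "metric_deriv (dbw_metric M) p v u w = - ?S" "metric_deriv (dbw_metric M) p w u v = - ?S"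
      by (simp_all add: metric_deriv_dbw[OF M p] mult_ac)
    ultimately show ?thesis by simp
  qed
  have zV: "?z \<in> lower_tri" by (auto simp: lower_tri_def)
  show "?z \<in> lower_tri \<and> (\<forall>w\<in>lower_tri. dbw_metric M p ?z w = (metric_deriv (dbw_metric M) p u v w
      + metric_deriv (dbw_metric M) p v u w - metric_deriv (dbw_metric M) p w u v) / 2)"
    using eq zV by blast
  fix z assume z: "z \<in> lower_tri \<and> (\<forall>w\<in>lower_tri. dbw_metric M p z w =
      (metric_deriv (dbw_metric M) p u v w
      + metric_deriv (dbw_metric M) p v u w - metric_deriv (dbw_metric M) p w u v) / 2)"
  have d: "z - ?z \<in> lower_tri" using z zV by (auto simp: lower_tri_def)
  \<comment> \<open>Testing both solutions against their difference gives that difference zero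
    length, so nondegeneracy makes it vanish.\<close>
  have "dbw_metric M p z (z - ?z) = dbw_metric M p ?z (z - ?z)"
    by (rule trans[OF bspec[OF conjunct2[OF z] d] eq[symmetric]])
  then have "dbw_coords_deriv M p (z - ?z) \<bullet> dbw_coords_deriv M p (z - ?z) = 0"
    by (simp only: dbw_metric_pullback[OF M p] dbw_coords_deriv_diff) (simp add: inner_diff_left)
  then have "z - ?z = 0"
    using dbw_coords_deriv_eq_0[OF M p d] by (simp only: inner_eq_zero_iff)
  then show "z = ?z" by simp
qed

section \<open>Parallel fields and geodesics\<close>

text \<open>Built from the endpoints alone, as a flat metric with trivial holonomy permits.\<close>

definition dbw_transport ::
  "'n::{finite,linorder} sq_mat \<Rightarrow> 'n sq_mat \<Rightarrow> 'n sq_mat \<Rightarrow> 'n sq_mat" where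
  "dbw_transport p q X =
     (\<chi> i j. if i = j then sqrt (q $ i $ i / p $ i $ i) * X $ i $ i else X $ i $ j)"

lemma dbw_transport_self:
  assumes "p \<in> cholesky"
  shows "dbw_transport p p X = X"
  using choleskyD[OF assms] by (auto simp: dbw_transport_def vec_eq_iff)

lemma parallel_field_on_dbw_iff:
  assumes M: "M \<in> pos_diag" and \<gamma>: "\<And>t. t \<in> T \<Longrightarrow> \<gamma> t \<in> cholesky"
  shows "parallel_field_on lower_tri (dbw_metric M) T \<gamma> W \<longleftrightarrow>
    (\<exists>\<gamma>'. \<forall>t\<in>T. (\<gamma> has_vector_derivative \<gamma>' t) (at t within T) \<and> W t \<in> lower_tri \<and>
      (W has_vector_derivative
        (\<chi> i j. if i = j then \<gamma>' t $ i $ i * W t $ i $ i / (2 * \<gamma> t $ i $ i) else 0)) (at t within T))"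
proof -
  have "- christoffel lower_tri (dbw_metric M) (\<gamma> t) u v =
      (\<chi> i j. if i = j then u $ i $ i * v $ i $ i / (2 * \<gamma> t $ i $ i) else 0)"
    if "t \<in> T" for t u v
    using that by (simp add: christoffel_dbw[OF M \<gamma>] vec_eq_iff)
  then show ?thesis unfolding parallel_field_on_def by simp
qed

text \<open>The constants of motion are compared at \<open>a\<close> and \<open>b\<close>. The curve
  is an arbitrary differentiable one, so the lemma serves both transport and the geodesic equation,
  where \<open>W\<close> is the velocity itself.\<close>

lemma parallel_field_on_dbw_imp_transport:
  assumes M: "M \<in> pos_diag" and \<gamma>: "\<And>t. t \<in> T \<Longrightarrow> \<gamma> t \<in> cholesky"
    and T: "is_interval T" and W: "parallel_field_on lower_tri (dbw_metric M) T \<gamma> W"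
    and a: "a \<in> T" and b: "b \<in> T"
  shows "W b = dbw_transport (\<gamma> a) (\<gamma> b) (W a)"
proof -
  obtain \<gamma>' where \<gamma>': "\<And>t. t \<in> T \<Longrightarrow> (\<gamma> has_vector_derivative \<gamma>' t) (at t within T)"
    and W': "\<And>t. t \<in> T \<Longrightarrow> (W has_vector_derivative
        (\<chi> i j. if i = j then \<gamma>' t $ i $ i * W t $ i $ i / (2 * \<gamma> t $ i $ i) else 0)) (at t within T)"
    using iffD1[OF parallel_field_on_dbw_iff[OF M \<gamma>] W] by blast
  have dg: "((\<lambda>x. \<gamma> x $ i $ i) has_real_derivative \<gamma>' t $ i $ i) (at t within T)"
    if "t \<in> T" for t i
    using \<gamma>'[OF that] by (simp add: has_vector_derivative_matrix_iff)
  have dW: "((\<lambda>x. W x $ i $ j) has_real_derivative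
      (if i = j then \<gamma>' t $ i $ i * W t $ i $ i / (2 * \<gamma> t $ i $ i) else 0)) (at t within T)"
    if "t \<in> T" for t i j
    using W'[OF that] by (simp add: has_vector_derivative_matrix_iff)
  have cT: "convex T" using T by (rule is_interval_convex)
  have "W b $ i $ j = dbw_transport (\<gamma> a) (\<gamma> b) (W a) $ i $ j" for i j
  proof (cases "i = j")
    case False
    then have "\<exists>c. \<forall>x\<in>T. W x $ i $ j = c"
      using dW[of _ i j] by (intro has_field_derivative_zero_constant[OF cT]) auto
    then show ?thesis using a b False by (auto simp: dbw_transport_def)
  next
    case True
    have pos: "0 < \<gamma> t $ i $ i" if "t \<in> T" for t using \<gamma>[OF that] by (rule choleskyD)
    have "((\<lambda>x. W x $ i $ i / sqrt (\<gamma> x $ i $ i)) has_real_derivative 0) (at t within T)"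
      if t: "t \<in> T" for t
    proof -
      let ?g = "\<gamma> t $ i $ i"
      have s: "((\<lambda>x. sqrt (\<gamma> x $ i $ i)) has_real_derivative inverse (sqrt ?g) / 2 * \<gamma>' t $ i $ i)
          (at t within T)"
        using pos[OF t] by (intro DERIV_chain2[OF DERIV_real_sqrt] dg t)
      have "sqrt ?g * sqrt ?g = ?g" using pos[OF t] by simp
      then show ?thesis
        using DERIV_divide[OF dW[OF t, of i i] s] pos[OF t]
        by (simp add: field_simps)
    qed
    then have "\<exists>c. \<forall>x\<in>T. W x $ i $ i / sqrt (\<gamma> x $ i $ i) = c"
      by (rule has_field_derivative_zero_constant[OF cT])
    then have "W b $ i $ i / sqrt (\<gamma> b $ i $ i) = W a $ i $ i / sqrt (\<gamma> a $ i $ i)"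
      using a b by auto
    then show ?thesis
      using True pos[OF a] pos[OF b]
      by (simp add: dbw_transport_def real_sqrt_divide field_simps)
  qed
  then show ?thesis by (simp add: vec_eq_iff)
qed

text \<open>The logarithmic derivative of \<open>sqrt (\<gamma> / p)\<close> is
  \<open>\<gamma>' / (2 * \<gamma>)\<close>, the coefficient of the parallel equation, for any fixed
  reference point \<open>p\<close>.\<close>

lemma parallel_field_on_dbw_transport:
  assumes M: "M \<in> pos_diag" and \<gamma>: "\<And>t. t \<in> T \<Longrightarrow> \<gamma> t \<in> cholesky"
    and \<gamma>': "\<And>t. t \<in> T \<Longrightarrow> (\<gamma> has_vector_derivative \<gamma>' t) (at t within T)"
    and p: "p \<in> cholesky" and X: "X \<in> lower_tri"
  shows "parallel_field_on lower_tri (dbw_metric M) T \<gamma> (\<lambda>t. dbw_transport p (\<gamma> t) X)"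
proof -
  have "((\<lambda>t. dbw_transport p (\<gamma> t) X) has_vector_derivative
     (\<chi> i j. if i = j then \<gamma>' t $ i $ i * dbw_transport p (\<gamma> t) X $ i $ i / (2 * \<gamma> t $ i $ i) else 0))
     (at t within T)" if t: "t \<in> T" for t
  proof -
    have "((\<lambda>x. sqrt (\<gamma> x $ i $ i / p $ i $ i) * X $ i $ i) has_real_derivative
       \<gamma>' t $ i $ i * (sqrt (\<gamma> t $ i $ i / p $ i $ i) * X $ i $ i) / (2 * \<gamma> t $ i $ i))
       (at t within T)" for i
    proof -
      let ?g = "\<gamma> t $ i $ i" and ?p = "p $ i $ i"
      have pos: "0 < ?g" "0 < ?p" using \<gamma>[OF t] p by (auto simp: choleskyD)
      have "((\<lambda>x. sqrt (\<gamma> x $ i $ i / ?p) * X $ i $ i) has_real_derivative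
          inverse (sqrt (?g / ?p)) / 2 * (\<gamma>' t $ i $ i / ?p) * X $ i $ i) (at t within T)"
        using pos \<gamma>'[OF t]
        by (intro DERIV_cmult_right DERIV_chain2[OF DERIV_real_sqrt] DERIV_cdivide)
          (auto simp: has_vector_derivative_matrix_iff)
      moreover have "inverse (sqrt (?g / ?p)) / 2 * (\<gamma>' t $ i $ i / ?p) * X $ i $ i
          = \<gamma>' t $ i $ i * (sqrt (?g / ?p) * X $ i $ i) / (2 * ?g)"
      proof -
        have "inverse (sqrt (?g / ?p)) / ?p = sqrt (?g / ?p) / ?g"
          using pos by (simp add: field_simps)
        then have "inverse (sqrt (?g / ?p)) / ?p * (\<gamma>' t $ i $ i * X $ i $ i / 2)
            = sqrt (?g / ?p) / ?g * (\<gamma>' t $ i $ i * X $ i $ i / 2)" by (simp only:)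
        then show ?thesis by (simp add: mult_ac)
      qed
      ultimately show ?thesis by simp
    qed
    then show ?thesis by (auto simp: has_vector_derivative_matrix_iff dbw_transport_def)
  qed
  moreover have "dbw_transport p q X \<in> lower_tri" for q
    using X by (auto simp: dbw_transport_def lower_tri_def)
  ultimately show ?thesis
    by (intro iffD2[OF parallel_field_on_dbw_iff[OF M \<gamma>]] exI[of _ \<gamma>'] ballI conjI \<gamma>')
qed

text \<open>The diagonal entry is the chart line
  \<open>sqrt (p / m) + t * v / (2 * sqrt (m * p))\<close>, squared and multiplied by
  \<open>m\<close>.\<close>

definition dbw_geodesic ::
  "'n::{finite,linorder} sq_mat \<Rightarrow> 'n sq_mat \<Rightarrow> real \<Rightarrow> 'n sq_mat" where
  "dbw_geodesic p v t = (\<chi> i j. if i = j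
     then p $ i $ i * (1 + t * v $ i $ i / (2 * p $ i $ i))\<^sup>2 else p $ i $ j + t * v $ i $ j)"

lemma dbw_geodesic_0: "dbw_geodesic p v 0 = p"
  by (simp add: dbw_geodesic_def vec_eq_iff)

lemma dbw_geodesic_has_vector_derivative:
  assumes p: "p \<in> cholesky"
  shows "(dbw_geodesic p v has_vector_derivative
    (\<chi> i j. if i = j then (1 + t * v $ i $ i / (2 * p $ i $ i)) * v $ i $ i else v $ i $ j))
    (at t within T)"
proof -
  have "((\<lambda>x. p $ i $ i * (1 + x * v $ i $ i / (2 * p $ i $ i))\<^sup>2) has_real_derivative
      (1 + t * v $ i $ i / (2 * p $ i $ i)) * v $ i $ i) (at t within T)" for i
  proof -
    have "((\<lambda>x. 1 + x * v $ i $ i / (2 * p $ i $ i)) has_real_derivative v $ i $ i / (2 * p $ i $ i))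
        (at t within T)"
      using choleskyD(3)[OF p, of i] by (auto intro!: derivative_eq_intros)
    from DERIV_cmult[OF DERIV_power[OF this, of 2], of "p $ i $ i"] show ?thesis
      using choleskyD(3)[OF p, of i] by (simp add: mult_ac)
  qed
  moreover have "((\<lambda>x. p $ i $ j + x * v $ i $ j) has_real_derivative v $ i $ j) (at t within T)" for i j
    by (auto intro!: derivative_eq_intros)
  ultimately show ?thesis
    unfolding has_vector_derivative_matrix_iff by (simp add: dbw_geodesic_def)
qed

text \<open>Fixes the sign of the root, which the diagonal entry of the geodesic, being
  \<open>p\<close> times a square, does not reveal.\<close>

lemma dbw_geodesic_pos:
  assumes "p \<in> cholesky" "0 < p $ i $ i + t / 2 * v $ i $ i"
  shows "0 < 1 + t * v $ i $ i / (2 * p $ i $ i)"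
  using assms(2) choleskyD[OF assms(1), of i] by (simp add: field_simps)

lemma dbw_geodesic_in_cholesky:
  assumes "p \<in> cholesky" "v \<in> lower_tri" "\<And>i. 0 < p $ i $ i + t / 2 * v $ i $ i"
  shows "dbw_geodesic p v t \<in> cholesky"
  using choleskyD[OF assms(1)] assms(2) dbw_geodesic_pos[OF assms(1) assms(3)]
  by (auto simp: dbw_geodesic_def cholesky_def lower_tri_def intro!: mult_pos_pos zero_less_power)

text \<open>While the root is positive it equals \<open>sqrt (\<gamma> / p)\<close>, so the velocity
  of the curve is the transport of \<open>v\<close> along it and hence parallel.\<close>

lemma geodesic_from_dbw:
  assumes M: "M \<in> pos_diag" and p: "p \<in> cholesky" and v: "v \<in> lower_tri"
    and T: "is_interval T" "0 \<in> T"
    and pos: "\<And>t i. t \<in> T \<Longrightarrow> 0 < p $ i $ i + t / 2 * v $ i $ i"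
  shows "geodesic_from lower_tri cholesky (dbw_metric M) p v T (dbw_geodesic p v)"
proof -
  have S: "dbw_geodesic p v t \<in> cholesky" if "t \<in> T" for t
    using dbw_geodesic_in_cholesky[OF p v pos[OF that]] .
  have d: "(dbw_geodesic p v has_vector_derivative dbw_transport p (dbw_geodesic p v t) v)
      (at t within T)" if t: "t \<in> T" for t
  proof -
    have sq: "sqrt (dbw_geodesic p v t $ i $ i / p $ i $ i) = 1 + t * v $ i $ i / (2 * p $ i $ i)" for i
      using dbw_geodesic_pos[OF p pos[OF t], of i] choleskyD[OF p, of i]
      by (simp add: dbw_geodesic_def)
    have "dbw_transport p (dbw_geodesic p v t) v
        = (\<chi> i j. if i = j then (1 + t * v $ i $ i / (2 * p $ i $ i)) * v $ i $ i else v $ i $ j)"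
      by (simp add: dbw_transport_def sq vec_eq_iff)
    then show ?thesis using dbw_geodesic_has_vector_derivative[OF p] by simp
  qed
  have "parallel_field_on lower_tri (dbw_metric M) T (dbw_geodesic p v)
      (\<lambda>t. dbw_transport p (dbw_geodesic p v t) v)"
    by (rule parallel_field_on_dbw_transport[OF M S d p v])
  then have "geodesic_on lower_tri cholesky (dbw_metric M) T (dbw_geodesic p v)"
    unfolding geodesic_on_def
    by (intro conjI exI[of _ "\<lambda>t. dbw_transport p (dbw_geodesic p v t) v"] ballI T S d)
  moreover have "(dbw_geodesic p v has_vector_derivative v) (at 0 within T)"
    using d[OF T(2)] by (simp add: dbw_geodesic_0 dbw_transport_self[OF p])
  ultimately show ?thesis using T(2) by (simp add: geodesic_from_def dbw_geodesic_0)
qed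

text \<open>A parallel velocity is the transport of \<open>v\<close>, so \<open>sqrt c\<close> has
  the constant derivative \<open>v / (2 * sqrt p)\<close> on the diagonal. The affine function
  \<open>p + t / 2 * v\<close> is then a product of two positive roots, which is why no geodesic
  outlives the positivity condition. \<open>nt\<close> excludes \<open>T = {0}\<close>, where every
  vector counts as a derivative and \<open>v\<close> would be unrelated to the velocity.\<close>

lemma geodesic_from_dbw_unique:
  assumes M: "M \<in> pos_diag" and c: "geodesic_from lower_tri cholesky (dbw_metric M) p v T c"
    and nt: "at 0 within T \<noteq> bot" and t: "t \<in> T"
  shows "0 < p $ i $ i + t / 2 * v $ i $ i" "c t = dbw_geodesic p v t"
proof -
  have T: "is_interval T" "0 \<in> T" and S: "\<And>t. t \<in> T \<Longrightarrow> c t \<in> cholesky" and c0: "c 0 = p"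
    and v: "(c has_vector_derivative v) (at 0 within T)"
    using c by (auto simp: geodesic_from_def geodesic_on_def)
  obtain c' where c': "\<And>t. t \<in> T \<Longrightarrow> (c has_vector_derivative c' t) (at t within T)"
    and par: "parallel_field_on lower_tri (dbw_metric M) T c c'"
    using c by (auto simp: geodesic_from_def geodesic_on_def)
  have p: "p \<in> cholesky" using S[OF T(2)] c0 by simp
  have "c' 0 = v" by (rule vector_derivative_unique_within[OF nt c'[OF T(2)] v])
  then have c'_eq: "c' t = dbw_transport p (c t) v" if "t \<in> T" for t
    using parallel_field_on_dbw_imp_transport[OF M S T(1) par T(2) that] c0 by simp
  have d: "((\<lambda>x. c x $ i $ j) has_real_derivative dbw_transport p (c t) v $ i $ j) (at t within T)"
    if "t \<in> T" for t i j
    using c'[OF that] c'_eq[OF that] by (simp add: has_vector_derivative_matrix_iff)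
  have cT: "convex T" using T(1) by (rule is_interval_convex)
  have pp: "0 < p $ i $ i" for i using p by (rule choleskyD)
  have sqrt_eq: "sqrt (c t $ i $ i) * sqrt (p $ i $ i) = p $ i $ i + t / 2 * v $ i $ i" for i
  proof -
    have "((\<lambda>x. sqrt (c x $ i $ i) * sqrt (p $ i $ i) - x / 2 * v $ i $ i) has_real_derivative 0)
        (at s within T)" if s: "s \<in> T" for s
    proof -
      have pos: "0 < c s $ i $ i" using S[OF s] by (rule choleskyD)
      have "((\<lambda>x. sqrt (c x $ i $ i) * sqrt (p $ i $ i) - x / 2 * v $ i $ i) has_real_derivative
          inverse (sqrt (c s $ i $ i)) / 2 * (dbw_transport p (c s) v $ i $ i) * sqrt (p $ i $ i)
          - 1 / 2 * v $ i $ i) (at s within T)"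
        by (intro DERIV_diff DERIV_cmult_right DERIV_chain2[OF DERIV_real_sqrt] DERIV_cdivide
            DERIV_ident d s pos)
      then show ?thesis
        using pos pp[of i] by (simp add: dbw_transport_def real_sqrt_divide field_simps)
    qed
    then have "\<exists>k. \<forall>x\<in>T. sqrt (c x $ i $ i) * sqrt (p $ i $ i) - x / 2 * v $ i $ i = k"
      by (rule has_field_derivative_zero_constant[OF cT])
    then obtain k where k: "\<And>x. x \<in> T \<Longrightarrow> sqrt (c x $ i $ i) * sqrt (p $ i $ i) - x / 2 * v $ i $ i = k"
      by blast
    show ?thesis using k[OF T(2)] k[OF t] pp[of i] by (simp add: c0)
  qed
  have "0 < sqrt (c t $ i $ i) * sqrt (p $ i $ i)" for i
    using choleskyD(1)[OF S[OF t]] pp by simp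
  then show "0 < p $ i $ i + t / 2 * v $ i $ i" for i using sqrt_eq by simp
  have "c t $ i $ j = dbw_geodesic p v t $ i $ j" for i j
  proof (cases "i = j")
    case True
    have ct: "0 < c t $ i $ i" using S[OF t] by (rule choleskyD)
    have "c t $ i $ i * p $ i $ i = (sqrt (c t $ i $ i) * sqrt (p $ i $ i))\<^sup>2"
      using ct pp[of i] by (simp add: power_mult_distrib)
    also have "\<dots> = (p $ i $ i * (1 + t * v $ i $ i / (2 * p $ i $ i)))\<^sup>2"
      using pp[of i] by (simp add: sqrt_eq distrib_left)
    also have "\<dots> = dbw_geodesic p v t $ i $ i * p $ i $ i"
      by (simp add: dbw_geodesic_def power_mult_distrib) (simp add: power2_eq_square)
    finally show ?thesis using True pp[of i] by simp
  next
    case False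
    have "((\<lambda>x. c x $ i $ j - x * v $ i $ j) has_real_derivative 0) (at s within T)" if s: "s \<in> T" for s
      using d[OF s, of i j] False
      by (auto intro!: derivative_eq_intros simp: dbw_transport_def)
    then have "\<exists>k. \<forall>x\<in>T. c x $ i $ j - x * v $ i $ j = k"
      by (rule has_field_derivative_zero_constant[OF cT])
    then obtain k where k: "\<And>x. x \<in> T \<Longrightarrow> c x $ i $ j - x * v $ i $ j = k"
      by blast
    show ?thesis using k[OF T(2)] k[OF t] False by (simp add: c0 dbw_geodesic_def)
  qed
  then show "c t = dbw_geodesic p v t" by (simp add: vec_eq_iff)
qed

section \<open>Logarithm, distance and Frechet mean\<close>

text \<open>Time 1 decides: positivity at times 0 and 1 passes to the convex combinations in
  between.\<close>

lemma exp_domain_dbw_iff: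
  assumes M: "M \<in> pos_diag" and p: "p \<in> cholesky"
  shows "v \<in> exp_domain lower_tri cholesky (dbw_metric M) p \<longleftrightarrow>
    v \<in> lower_tri \<and> (\<forall>i. 0 < p $ i $ i + 1 / 2 * v $ i $ i)"
proof
  assume "v \<in> exp_domain lower_tri cholesky (dbw_metric M) p"
  then obtain \<gamma> where v: "v \<in> lower_tri"
    and \<gamma>: "geodesic_from lower_tri cholesky (dbw_metric M) p v {0..1} \<gamma>"
    by (auto simp: exp_domain_def)
  have "0 < p $ i $ i + 1 / 2 * v $ i $ i" for i
    using geodesic_from_dbw_unique(1)[OF M \<gamma>, of 1] by (simp add: trivial_limit_within)
  then show "v \<in> lower_tri \<and> (\<forall>i. 0 < p $ i $ i + 1 / 2 * v $ i $ i)" using v by blast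
next
  assume v: "v \<in> lower_tri \<and> (\<forall>i. 0 < p $ i $ i + 1 / 2 * v $ i $ i)"
  have "0 < p $ i $ i + t / 2 * v $ i $ i" if "t \<in> {0..1}" for t i
  proof -
    let ?d = "p $ i $ i" and ?e = "p $ i $ i + 1 / 2 * v $ i $ i"
    have "0 < ?d" "0 < ?e" using v p by (auto simp: choleskyD)
    then have "0 < (1 - t) * ?d + t * ?e"
      using that by (cases "t = 0") (auto intro!: add_nonneg_pos mult_nonneg_nonneg mult_pos_pos)
    also have "(1 - t) * ?d + t * ?e = ?d + t / 2 * v $ i $ i" by (simp add: algebra_simps)
    finally show ?thesis .
  qed
  then have "geodesic_from lower_tri cholesky (dbw_metric M) p v {0..1} (dbw_geodesic p v)"
    using v by (intro geodesic_from_dbw[OF M p]) auto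
  then show "v \<in> exp_domain lower_tri cholesky (dbw_metric M) p"
    using v by (auto simp: exp_domain_def)
qed

lemma riem_exp_dbw:
  assumes M: "M \<in> pos_diag" and v: "v \<in> exp_domain lower_tri cholesky (dbw_metric M) p"
  shows "riem_exp lower_tri cholesky (dbw_metric M) p v = dbw_geodesic p v 1"
proof -
  have "\<gamma> 1 = dbw_geodesic p v 1"
    if "geodesic_from lower_tri cholesky (dbw_metric M) p v {0..1} \<gamma>" for \<gamma>
    using geodesic_from_dbw_unique(2)[OF M that, of 1] by (simp add: trivial_limit_within)
  then show ?thesis
    using v unfolding riem_exp_def exp_domain_def by (intro the_equality) blast+
qed

text \<open>On the diagonal, the \<open>v\<close> for which \<open>1 + v / (2 * p)\<close> is the
  positive square root of \<open>q / p\<close>.\<close>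

definition dbw_log ::
  "'n::{finite,linorder} sq_mat \<Rightarrow> 'n sq_mat \<Rightarrow> 'n sq_mat" where
  "dbw_log p q = (\<chi> i j. if i = j
     then 2 * p $ i $ i * (sqrt (q $ i $ i / p $ i $ i) - 1) else q $ i $ j - p $ i $ j)"

lemma dbw_log_exp_domain:
  assumes M: "M \<in> pos_diag" and p: "p \<in> cholesky" and q: "q \<in> cholesky"
  shows "dbw_log p q \<in> exp_domain lower_tri cholesky (dbw_metric M) p"
  unfolding exp_domain_dbw_iff[OF M p]
proof
  show "dbw_log p q \<in> lower_tri"
    using choleskyD(2)[OF p] choleskyD(2)[OF q] by (auto simp: dbw_log_def lower_tri_def)
  show "\<forall>i. 0 < p $ i $ i + 1 / 2 * dbw_log p q $ i $ i"
    using choleskyD(1)[OF p] choleskyD(1)[OF q] by (simp add: dbw_log_def algebra_simps)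
qed

text \<open>The diagonal equation \<open>p * (1 + v / (2 * p))\<^sup>2 = q\<close> also has a
  solution with negative root; membership in the exponential domain rules it out and makes the
  logarithm single valued.\<close>

lemma dbw_geodesic_1_eq_iff:
  assumes M: "M \<in> pos_diag" and p: "p \<in> cholesky" and q: "q \<in> cholesky"
    and v: "v \<in> exp_domain lower_tri cholesky (dbw_metric M) p"
  shows "dbw_geodesic p v 1 = q \<longleftrightarrow> v = dbw_log p q"
proof -
  have pos: "0 < p $ i $ i + 1 / 2 * v $ i $ i" for i
    using v by (simp add: exp_domain_dbw_iff[OF M p])
  have "dbw_geodesic p v 1 $ i $ j = q $ i $ j \<longleftrightarrow> v $ i $ j = dbw_log p q $ i $ j" for i j
  proof (cases "i = j")
    case True
    let ?a = "1 + v $ i $ i / (2 * p $ i $ i)"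
    have pp: "0 < p $ i $ i" "0 < q $ i $ i" using p q by (auto simp: choleskyD)
    have a: "0 < ?a" using dbw_geodesic_pos[OF p pos, of i] by simp
    have "p $ i $ i * ?a\<^sup>2 = q $ i $ i \<longleftrightarrow> ?a\<^sup>2 = q $ i $ i / p $ i $ i"
      using pp by (auto simp: field_simps)
    also have "\<dots> \<longleftrightarrow> ?a = sqrt (q $ i $ i / p $ i $ i)"
      using a pp by (metis less_imp_le real_sqrt_pow2 real_sqrt_unique zero_le_divide_iff)
    also have "\<dots> \<longleftrightarrow> v $ i $ i = 2 * p $ i $ i * (sqrt (q $ i $ i / p $ i $ i) - 1)"
      using pp(1) by (auto simp: field_simps)
    finally show ?thesis using True by (simp add: dbw_geodesic_def dbw_log_def)
  next
    case False
    then show ?thesis by (auto simp: dbw_geodesic_def dbw_log_def)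
  qed
  then show ?thesis by (simp add: vec_eq_iff)
qed

lemma geodesic_joining_dbw:
  assumes M: "M \<in> pos_diag" and p: "p \<in> cholesky" and q: "q \<in> cholesky"
  shows "geodesic_joining lower_tri cholesky (dbw_metric M) p q (dbw_geodesic p (dbw_log p q))"
proof -
  note d = dbw_log_exp_domain[OF M p q]
  obtain \<gamma> where \<gamma>: "geodesic_from lower_tri cholesky (dbw_metric M) p (dbw_log p q) {0..1} \<gamma>"
    using d by (auto simp: exp_domain_def)
  \<comment> \<open>Positivity on the whole segment is read off from whatever geodesic the
    membership in \<open>exp_domain\<close> provides.\<close>
  have pos: "0 < p $ i $ i + t / 2 * dbw_log p q $ i $ i" if "t \<in> {0..1}" for t i
    using that by (intro geodesic_from_dbw_unique(1)[OF M \<gamma>]) (auto simp: trivial_limit_within)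
  have "geodesic_from lower_tri cholesky (dbw_metric M) p (dbw_log p q) {0..1}
      (dbw_geodesic p (dbw_log p q))"
    using d pos by (intro geodesic_from_dbw[OF M p]) (auto simp: exp_domain_def)
  then show ?thesis
    using dbw_geodesic_1_eq_iff[OF M p q d]
    by (simp add: geodesic_joining_def geodesic_from_def)
qed

text \<open>Transport depends on the endpoints only, so all geodesics from \<open>p\<close> to
  \<open>q\<close> give the same result and their uniqueness need not be settled.\<close>

lemma transports_to_dbw_iff:
  assumes M: "M \<in> pos_diag" and \<gamma>: "geodesic_joining lower_tri cholesky (dbw_metric M) p q \<gamma>"
    and X: "X \<in> lower_tri"
  shows "transports_to lower_tri (dbw_metric M) \<gamma> X Z \<longleftrightarrow> Z = dbw_transport p q X"
proof -
  have S: "\<And>t. t \<in> {0..1} \<Longrightarrow> \<gamma> t \<in> cholesky" and e: "\<gamma> 0 = p" "\<gamma> 1 = q"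
    using \<gamma> by (auto simp: geodesic_joining_def geodesic_on_def)
  obtain \<gamma>' where \<gamma>': "\<And>t. t \<in> {0..1} \<Longrightarrow> (\<gamma> has_vector_derivative \<gamma>' t) (at t within {0..1})"
    using \<gamma> unfolding geodesic_joining_def geodesic_on_def by blast
  have p: "p \<in> cholesky" using S[of 0] e by simp
  show ?thesis
  proof
    assume "transports_to lower_tri (dbw_metric M) \<gamma> X Z"
    then obtain W where W: "parallel_field_on lower_tri (dbw_metric M) {0..1} \<gamma> W" "W 0 = X" "W 1 = Z"
      by (auto simp: transports_to_def)
    then show "Z = dbw_transport p q X"
      using parallel_field_on_dbw_imp_transport[OF M S is_interval_cc W(1), of 0 1] e by simp
  next
    assume "Z = dbw_transport p q X"
    then show "transports_to lower_tri (dbw_metric M) \<gamma> X Z"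
      unfolding transports_to_def
      using parallel_field_on_dbw_transport[OF M S \<gamma>' p X] e dbw_transport_self[OF p]
      by (intro exI[of _ "\<lambda>t. dbw_transport p (\<gamma> t) X"]) simp
  qed
qed

section \<open>Geodesic distance\<close>

lemma riem_length_ge_coords_diff:
  assumes M: "M \<in> pos_diag" and \<gamma>: "valid_path \<gamma>" "path_image \<gamma> \<subseteq> cholesky"
    and l: "has_riem_length (dbw_metric M) \<gamma> l"
  shows "norm (dbw_coords M (pathfinish \<gamma>) - dbw_coords M (pathstart \<gamma>)) \<le> l"
proof -
  obtain S D where S: "finite S" and cont: "continuous_on {0..1} \<gamma>"
    and D: "\<And>t. t \<in> {0..1} - S \<Longrightarrow> (\<gamma> has_vector_derivative D t) (at t)"
    using \<gamma>(1)
    unfolding valid_path_def piecewise_C1_differentiable_on_def C1_differentiable_on_def by blast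
  have ch: "\<gamma> t \<in> cholesky" if "t \<in> {0..1}" for t
    using \<gamma>(2) that by (auto simp: path_image_def)
  \<comment> \<open>\<open>f\<close> vanishes on the exceptional set because the metric length integrand there involves an
    unspecified vector derivative, of which only nonnegativity is known.\<close>
  define f where "f t = (if t \<in> S then 0 else dbw_coords_deriv M (\<gamma> t) (D t))" for t
  have "continuous_on {0..1} (\<lambda>t. dbw_coords M (\<gamma> t))"
    unfolding dbw_coords_def
  proof (intro continuous_on_vec_lambda)
    fix i j
    show "continuous_on {0..1} (\<lambda>t. if i = j then sqrt (\<gamma> t $ i $ i / M $ i $ i)
        else if j < i then \<gamma> t $ i $ j else 0)"
      using pos_diagD(3)[OF M, of i]
      by (cases "i = j"; cases "j < i") (auto intro!: continuous_intros cont)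
  qed
  then have f: "(f has_integral (dbw_coords M (\<gamma> 1) - dbw_coords M (\<gamma> 0))) {0..1}"
    using S
    by (intro fundamental_theorem_of_calculus_strong)
      (auto simp: f_def intro!: dbw_coords_deriv_has_vector_derivative[OF M ch D])
  \<comment> \<open>The integral of \<open>f\<close> is the displacement in the chart, and
    \<open>norm (f t)\<close> is the metric speed outside \<open>S\<close>: no path is shorter than
    the chart segment.\<close>
  have "norm (integral {0..1} f) \<le> integral {0..1}
      (\<lambda>t. sqrt (dbw_metric M (\<gamma> t) (vector_derivative \<gamma> (at t)) (vector_derivative \<gamma> (at t))))"
  proof (rule integral_norm_bound_integral)
    fix t :: real assume t: "t \<in> {0..1}"
    show "norm (f t) \<le>
        sqrt (dbw_metric M (\<gamma> t) (vector_derivative \<gamma> (at t)) (vector_derivative \<gamma> (at t)))"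
    proof (cases "t \<in> S")
      case False
      then have "vector_derivative \<gamma> (at t) = D t" using D t by (intro vector_derivative_at) auto
      then show ?thesis using False
        by (simp add: f_def dbw_metric_pullback[OF M ch[OF t]] norm_eq_sqrt_inner)
    qed (simp add: f_def dbw_metric_pullback[OF M ch[OF t]])
  qed (use f l in \<open>auto simp: has_riem_length_def\<close>)
  then show ?thesis
    using f l by (simp add: has_riem_length_def integral_unique pathstart_def pathfinish_def)
qed

text \<open>The root appears once in the velocity and once in \<open>sqrt \<gamma>\<close>, and
  cancels because it is positive: the chart velocity is the constant \<open>?c\<close>, which is
  also the chart displacement over unit time.\<close>

lemma has_riem_length_dbw_geodesic:
  assumes M: "M \<in> pos_diag" and p: "p \<in> cholesky" and v: "v \<in> lower_tri"
    and pos: "\<And>t i. t \<in> {0..1} \<Longrightarrow> 0 < p $ i $ i + t / 2 * v $ i $ i"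
  shows "has_riem_length (dbw_metric M) (dbw_geodesic p v)
    (norm (dbw_coords M (dbw_geodesic p v 1) - dbw_coords M p))"
proof -
  let ?c = "dbw_coords_deriv M p v"
  let ?\<gamma> = "dbw_geodesic p v"
  let ?v = "\<lambda>t. \<chi> i j. if i = j then (1 + t * v $ i $ i / (2 * p $ i $ i)) * v $ i $ i else v $ i $ j"
  have der: "vector_derivative ?\<gamma> (at t) = ?v t" for t
    by (rule vector_derivative_at[OF dbw_geodesic_has_vector_derivative[OF p]])
  have a: "0 < 1 + t * v $ i $ i / (2 * p $ i $ i)" if "t \<in> {0..1}" for t i
    using dbw_geodesic_pos[OF p pos[OF that]] .
  have "dbw_coords_deriv M (?\<gamma> t) (?v t) = ?c" if t: "t \<in> {0..1}" for t
  proof -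
    have "x * y / (2 * sqrt (m * (q * x\<^sup>2))) = y / (2 * sqrt (m * q))" if "0 < x" for x y m q :: real
      using that by (simp add: real_sqrt_mult)
    then show ?thesis using a[OF t]
      by (auto simp: dbw_coords_deriv_def dbw_geodesic_def vec_eq_iff)
  qed
  then have "norm ?c = sqrt (dbw_metric M (?\<gamma> t) (vector_derivative ?\<gamma> (at t)) (vector_derivative ?\<gamma> (at t)))"
    if "t \<in> {0..1}" for t
    using that dbw_metric_pullback[OF M dbw_geodesic_in_cholesky[OF p v pos[OF that]]]
    by (simp add: der norm_eq_sqrt_inner)
  moreover have "((\<lambda>t::real. norm ?c) has_integral norm ?c) {0..1}"
    using has_integral_const_real[of "norm ?c" 0 1] by simp
  ultimately have "has_riem_length (dbw_metric M) ?\<gamma> (norm ?c)"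
    unfolding has_riem_length_def by (rule has_integral_eq)
  moreover have "dbw_coords M (?\<gamma> 1) - dbw_coords M p = ?c"
  proof -
    have "sqrt (p $ i $ i * (1 + v $ i $ i / (2 * p $ i $ i))\<^sup>2 / M $ i $ i) - sqrt (p $ i $ i / M $ i $ i)
        = v $ i $ i / (2 * sqrt (M $ i $ i * p $ i $ i))" for i
    proof -
      let ?m = "M $ i $ i" and ?p = "p $ i $ i" and ?x = "1 + v $ i $ i / (2 * p $ i $ i)"
      have mp: "0 < ?m" "0 < ?p" using M p by (auto simp: pos_diagD choleskyD)
      have "sqrt (?p * ?x\<^sup>2 / ?m) = sqrt ?p / sqrt ?m * ?x"
        using a[of 1 i] by (simp add: real_sqrt_mult real_sqrt_divide)
      then have "sqrt (?p * ?x\<^sup>2 / ?m) - sqrt (?p / ?m) = sqrt ?p / sqrt ?m * (?x - 1)"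
        by (simp only: real_sqrt_divide right_diff_distrib mult_1_right)
      \<comment> \<open>Here \<open>?x - 1 = v / (2 * p)\<close>, with \<open>p\<close> written as a
        product of two roots so that one of them cancels.\<close>
      also have "\<dots> = (sqrt ?p / (sqrt ?p * sqrt ?p)) * (v $ i $ i / (2 * sqrt ?m))"
        using mp by simp
      also have "\<dots> = v $ i $ i / (2 * sqrt (?m * ?p))"
        using mp by (simp add: real_sqrt_mult del: real_sqrt_mult_self)
      finally show ?thesis .
    qed
    then show ?thesis
      by (auto simp: dbw_coords_def dbw_coords_deriv_def dbw_geodesic_def vec_eq_iff)
  qed
  ultimately show ?thesis by simp
qed

text \<open>The infimum is a minimum: the explicit geodesic attains the lower bound valid for all
  paths. Convexity of the chart image enters through \<open>dbw_log_exp_domain\<close>, which keeps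
  the segment inside the manifold.\<close>

lemma geodesic_dist_dbw:
  assumes M: "M \<in> pos_diag" and p: "p \<in> cholesky" and q: "q \<in> cholesky"
  shows "geodesic_dist cholesky (dbw_metric M) p q = norm (dbw_coords M q - dbw_coords M p)"
  unfolding geodesic_dist_def
proof (rule cInf_eq_minimum)
  let ?v = "dbw_log p q"
  let ?\<gamma> = "dbw_geodesic p ?v"
  note join = geodesic_joining_dbw[OF M p q]
  have v: "?v \<in> lower_tri"
    using dbw_log_exp_domain[OF M p q] by (auto simp: exp_domain_def)
  obtain \<gamma> where \<gamma>: "geodesic_from lower_tri cholesky (dbw_metric M) p ?v {0..1} \<gamma>"
    using dbw_log_exp_domain[OF M p q] by (auto simp: exp_domain_def)
  have pos: "0 < p $ i $ i + t / 2 * ?v $ i $ i" if "t \<in> {0..1}" for t i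
    using that by (intro geodesic_from_dbw_unique(1)[OF M \<gamma>]) (auto simp: trivial_limit_within)
  have "?\<gamma> C1_differentiable_on {0..1}"
    unfolding C1_differentiable_on_def
  proof (intro exI conjI ballI)
    show "(?\<gamma> has_vector_derivative
      (\<chi> i j. if i = j then (1 + t * ?v $ i $ i / (2 * p $ i $ i)) * ?v $ i $ i else ?v $ i $ j)) (at t)" for t
      by (rule dbw_geodesic_has_vector_derivative[OF p])
    show "continuous_on {0..1} (\<lambda>t. \<chi> i j. if i = j
      then (1 + t * ?v $ i $ i / (2 * p $ i $ i)) * ?v $ i $ i else ?v $ i $ j)"
    proof (intro continuous_on_vec_lambda)
      fix i j
      show "continuous_on {0..1} (\<lambda>t. if i = j
          then (1 + t * ?v $ i $ i / (2 * p $ i $ i)) * ?v $ i $ i else ?v $ i $ j)"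
        using choleskyD(3)[OF p, of i] by (cases "i = j") (auto intro!: continuous_intros)
    qed
  qed
  then have "valid_path ?\<gamma>"
    unfolding valid_path_def by (rule C1_differentiable_imp_piecewise)
  moreover have "path_image ?\<gamma> \<subseteq> cholesky" "pathstart ?\<gamma> = p" "pathfinish ?\<gamma> = q"
    using join
    by (auto simp: geodesic_joining_def geodesic_on_def path_image_def pathstart_def pathfinish_def)
  moreover have "has_riem_length (dbw_metric M) ?\<gamma> (norm (dbw_coords M q - dbw_coords M p))"
    using has_riem_length_dbw_geodesic[OF M p v pos] join by (simp add: geodesic_joining_def)
  ultimately show "norm (dbw_coords M q - dbw_coords M p) \<in> {l. \<exists>\<gamma>. valid_path \<gamma> \<and>
      path_image \<gamma> \<subseteq> cholesky \<and> pathstart \<gamma> = p \<and> pathfinish \<gamma> = q \<and>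
      has_riem_length (dbw_metric M) \<gamma> l}"
    by blast
next
  fix l assume "l \<in> {l. \<exists>\<gamma>. valid_path \<gamma> \<and>
      path_image \<gamma> \<subseteq> cholesky \<and> pathstart \<gamma> = p \<and> pathfinish \<gamma> = q \<and>
      has_riem_length (dbw_metric M) \<gamma> l}"
  then show "norm (dbw_coords M q - dbw_coords M p) \<le> l"
    using riem_length_ge_coords_diff[OF M] by blast
qed

section \<open>Weighted Frechet mean\<close>

lemma dbw_coords_inj:
  assumes M: "M \<in> pos_diag" and p: "p \<in> cholesky" and q: "q \<in> cholesky"
    and eq: "dbw_coords M p = dbw_coords M q"
  shows "p = q"
proof -
  have "p $ i $ j = q $ i $ j" for i j
  proof (cases i j rule: linorder_cases)
    case less then show ?thesis using choleskyD(2)[OF p] choleskyD(2)[OF q] by simp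
  next
    case equal
    have "dbw_coords M p $ i $ i = dbw_coords M q $ i $ i" using eq by simp
    \<comment> \<open>\<open>sqrt\<close> is odd and injective on all reals, so cancelling the
      nonzero entry of \<open>M\<close> suffices.\<close>
    then show ?thesis using equal pos_diagD(3)[OF M, of i] by (simp add: dbw_coords_def)
  next
    case greater
    have "dbw_coords M p $ i $ j = dbw_coords M q $ i $ j" using eq by simp
    then show ?thesis using greater by (simp add: dbw_coords_def split: if_splits)
  qed
  then show ?thesis by (simp add: vec_eq_iff)
qed

text \<open>The Huygens-Steiner identity: the weighted deviations from the barycenter sum to 0, so
  the cross terms disappear.\<close>

lemma sum_weighted_sq_dist_barycenter:
  fixes x :: "'a::real_inner"
  assumes "finite I" "(\<Sum>i\<in>I. w i) = 1"
  shows "(\<Sum>i\<in>I. w i * (norm (a i - x))\<^sup>2) =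
    (norm (x - (\<Sum>i\<in>I. w i *\<^sub>R a i)))\<^sup>2 + (\<Sum>i\<in>I. w i * (norm (a i - (\<Sum>i\<in>I. w i *\<^sub>R a i)))\<^sup>2)"
proof -
  let ?m = "\<Sum>i\<in>I. w i *\<^sub>R a i"
  \<comment> \<open>\<open>a i - x\<close> is split at \<open>?m\<close>, with the weight kept
    inside the inner product so that the sum of the cross terms can be moved into its first
    argument.\<close>
  have "w i * (norm (a i - x))\<^sup>2 = w i * (norm (x - ?m))\<^sup>2
      + 2 * ((w i *\<^sub>R a i - w i *\<^sub>R ?m) \<bullet> (?m - x)) + w i * (norm (a i - ?m))\<^sup>2" for i
    by (simp add: power2_norm_eq_inner inner_diff_left inner_diff_right inner_commute algebra_simps)
  moreover have "(\<Sum>i\<in>I. w i *\<^sub>R a i - w i *\<^sub>R ?m) = 0"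
    using assms(2) by (simp add: sum_subtractf scaleR_left.sum[symmetric])
  ultimately show ?thesis
    using assms(2)
    by (simp add: sum.distrib sum_distrib_left[symmetric] sum_distrib_right[symmetric]
        inner_sum_left[symmetric])
qed

text \<open>By the Steiner identity in the chart, the objective at \<open>q\<close> exceeds its
  value at \<open>p\<close> by the squared chart distance; injectivity of the chart then gives
  uniqueness.\<close>

lemma is_frechet_mean_dbw_iff:
  assumes M: "M \<in> pos_diag" and I: "finite I" "(\<Sum>i\<in>I. w i) = 1"
    and x: "\<And>i. i \<in> I \<Longrightarrow> x i \<in> cholesky"
    and p: "p \<in> cholesky" "dbw_coords M p = (\<Sum>i\<in>I. w i *\<^sub>R dbw_coords M (x i))"
  shows "is_frechet_mean cholesky (dbw_metric M) I w x q \<longleftrightarrow> q = p"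
proof -
  let ?F = "\<lambda>q. \<Sum>i\<in>I. w i * (geodesic_dist cholesky (dbw_metric M) q (x i))\<^sup>2"
  have "?F q = (\<Sum>i\<in>I. w i * (norm (dbw_coords M (x i) - dbw_coords M q))\<^sup>2)" if "q \<in> cholesky" for q
    using x by (intro sum.cong refl) (simp add: geodesic_dist_dbw[OF M that])
  then have F: "?F q = (norm (dbw_coords M q - dbw_coords M p))\<^sup>2 + ?F p" if "q \<in> cholesky" for q
    using that p(1)
      sum_weighted_sq_dist_barycenter[OF I, of "\<lambda>i. dbw_coords M (x i)" "dbw_coords M q"]
    by (simp add: p(2))
  show ?thesis
  proof
    assume "is_frechet_mean cholesky (dbw_metric M) I w x q"
    then have q: "q \<in> cholesky" "\<not> ?F p < ?F q"
      using p(1) by (auto simp: is_frechet_mean_def is_arg_min_def)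
    then have "(norm (dbw_coords M q - dbw_coords M p))\<^sup>2 \<le> 0" using F[OF q(1)] by linarith
    then have "dbw_coords M q = dbw_coords M p" by simp
    then show "q = p" by (rule dbw_coords_inj[OF M q(1) p(1)])
  next
    assume "q = p"
    moreover have "\<not> ?F r < ?F p" if "r \<in> cholesky" for r
      using F[OF that] by simp
    ultimately show "is_frechet_mean cholesky (dbw_metric M) I w x q"
      using p(1) by (auto simp: is_frechet_mean_def is_arg_min_def)
  qed
qed

section \<open>Matrix forms\<close>

lemma powr_neg_half: "0 < x \<Longrightarrow> x powr - (1/2) = 1 / sqrt x" for x :: real
  using powr_minus_divide[of x "1/2"] by (simp add: powr_half_sqrt)

lemma diag_part_pos_diag: "p \<in> cholesky \<Longrightarrow> diag_part p \<in> pos_diag"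
  by (simp add: cholesky_def pos_diag_def diag_part_def)

lemma diag_part_nth: "diag_part A $ i $ j = (if i = j then A $ i $ i else 0)"
  by (simp add: diag_part_def)

lemma diag_part_mult: "(diag_part D ** A) $ i $ j = D $ i $ i * A $ i $ j"
  by (subst matrix_mult_diag_left) (auto simp: diag_part_nth)

lemma matrix_inv_diag_part_mult:
  assumes "p \<in> cholesky"
  shows "(matrix_inv (diag_part p) ** A) $ i $ j = A $ i $ j / p $ i $ i"
  by (subst matrix_mult_diag_left)
    (auto simp: matrix_inv_diag[OF diag_part_pos_diag[OF assms]] diag_part_nth)

lemma mat_square_diag:
  assumes "\<And>i j. i \<noteq> j \<Longrightarrow> D $ i $ j = 0"
  shows "mat_square D $ i $ j = (if i = j then (D $ i $ i)\<^sup>2 else 0)"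
  unfolding mat_square_def
  by (subst matrix_mult_diag_left[OF assms]) (auto simp: assms power2_eq_square)

lemma dbw_metric_matrix_form:
  fixes M p u v :: "'n::{finite,linorder} sq_mat"
  assumes M: "M \<in> pos_diag" and p: "p \<in> cholesky"
  shows "dbw_metric M p u v = strict_lower u \<bullet> strict_lower v +
    1/4 * ((matrix_inv (diag_part p) ** diag_part u) \<bullet> (matrix_inv M ** diag_part v))"
proof -
  have "(matrix_inv M ** A) $ i $ j = A $ i $ j / M $ i $ i" for A :: "'n sq_mat" and i j
    by (subst matrix_mult_diag_left) (auto simp: matrix_inv_diag[OF M])
  then have "(matrix_inv (diag_part p) ** diag_part u) \<bullet> (matrix_inv M ** diag_part v)
      = (\<Sum>i\<in>UNIV. \<Sum>j\<in>UNIV. if i = j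
          then u $ i $ i * v $ i $ i / (M $ i $ i * p $ i $ i) else 0)"
    unfolding inner_vec_def
    by (intro sum.cong refl) (auto simp: matrix_inv_diag_part_mult[OF p] diag_part_nth mult_ac)
  then show ?thesis
    by (simp add: dbw_metric_eq[OF M p] sum_divide_distrib mult_ac)
qed

text \<open>\<open>dbw_geodesic\<close> keeps the entries above the diagonal and the matrix
  expression drops them; both vanish there because \<open>p\<close> and \<open>v\<close> are lower
  triangular.\<close>

lemma dbw_geodesic_matrix_form:
  assumes p: "p \<in> cholesky" and v: "v \<in> lower_tri"
  shows "dbw_geodesic p v t = strict_lower p + t *\<^sub>R strict_lower v +
    diag_part p ** mat_square (mat 1 + (t/2) *\<^sub>R (matrix_inv (diag_part p) ** diag_part v))"
proof -
  let ?D = "mat 1 + (t/2) *\<^sub>R (matrix_inv (diag_part p) ** diag_part v)"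
  have D: "?D $ i $ j = (if i = j then 1 + t * v $ i $ i / (2 * p $ i $ i) else 0)" for i j
    by (simp add: mat_def matrix_inv_diag_part_mult[OF p] diag_part_nth)
  have "mat_square ?D $ i $ j = (if i = j then (?D $ i $ i)\<^sup>2 else 0)" for i j
    \<comment> \<open>\<open>vector_add_component\<close> would split the entries of
      \<open>?D\<close> before \<open>D\<close> could rewrite them.\<close>
    by (rule mat_square_diag) (simp add: D del: vector_add_component)
  then have "mat_square ?D $ i $ j
      = (if i = j then (1 + t * v $ i $ i / (2 * p $ i $ i))\<^sup>2 else 0)" for i j
    by (simp add: D del: vector_add_component)
  then show ?thesis
    using choleskyD(2)[OF p] v
    by (auto simp: vec_eq_iff dbw_geodesic_def diag_part_mult strict_lower_def lower_tri_def
        not_less_iff_gr_or_eq)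
qed

lemma sqrt_ratio_matrix_form:
  assumes p: "p \<in> cholesky" and q: "q \<in> cholesky"
  shows "diag_powr (matrix_inv (diag_part p) ** diag_part q) (1/2) $ i $ j
    = (if i = j then sqrt (q $ i $ i / p $ i $ i) else 0)"
  using choleskyD(1)[OF p] choleskyD(1)[OF q]
  by (simp add: diag_powr_def matrix_inv_diag_part_mult[OF p] diag_part_nth powr_half_sqrt
      less_imp_le)

lemma dbw_log_matrix_form:
  assumes p: "p \<in> cholesky" and q: "q \<in> cholesky"
  shows "dbw_log p q = strict_lower q - strict_lower p +
    2 *\<^sub>R (diag_part p ** (diag_powr (matrix_inv (diag_part p) ** diag_part q) (1/2) - mat 1))"
  using choleskyD(2)[OF p] choleskyD(2)[OF q]
  by (auto simp: vec_eq_iff dbw_log_def strict_lower_def diag_part_mult sqrt_ratio_matrix_form[OF p q]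
      mat_def not_less_iff_gr_or_eq)

lemma dbw_transport_matrix_form:
  assumes p: "p \<in> cholesky" and q: "q \<in> cholesky" and X: "X \<in> lower_tri"
  shows "dbw_transport p q X = strict_lower X +
    diag_powr (matrix_inv (diag_part p) ** diag_part q) (1/2) ** diag_part X"
proof -
  have "(diag_powr (matrix_inv (diag_part p) ** diag_part q) (1/2) ** diag_part X) $ i $ j
      = sqrt (q $ i $ i / p $ i $ i) * diag_part X $ i $ j" for i j
    by (subst matrix_mult_diag_left) (simp_all add: sqrt_ratio_matrix_form[OF p q])
  then show ?thesis
    using X by (auto simp: vec_eq_iff dbw_transport_def strict_lower_def diag_part_nth lower_tri_def
        not_less_iff_gr_or_eq)
qed

text \<open>The constant \<open>1 / sqrt m\<close> in each diagonal chart coordinate is the source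
  of \<open>diag_powr M (-1/2)\<close>.\<close>

lemma norm_dbw_coords_diff_squared:
  assumes M: "M \<in> pos_diag" and p: "p \<in> cholesky" and q: "q \<in> cholesky"
  shows "(norm (dbw_coords M q - dbw_coords M p))\<^sup>2 = (norm (strict_lower q - strict_lower p))\<^sup>2 +
    (norm (diag_powr M (-1/2) ** (diag_powr (diag_part q) (1/2) - diag_powr (diag_part p) (1/2))))\<^sup>2"
proof -
  let ?d = "\<lambda>i. (sqrt (q $ i $ i / M $ i $ i) - sqrt (p $ i $ i / M $ i $ i))\<^sup>2"
  have D: "(diag_powr M (-1/2) ** (diag_powr (diag_part q) (1/2) - diag_powr (diag_part p) (1/2))) $ i $ j
      = (if i = j then sqrt (q $ i $ i / M $ i $ i) - sqrt (p $ i $ i / M $ i $ i) else 0)" for i j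
    using pos_diagD(1)[OF M, of i] choleskyD(1)[OF p, of i] choleskyD(1)[OF q, of i]
    by (subst matrix_mult_diag_left)
      (auto simp: diag_powr_def diag_part_nth powr_neg_half powr_half_sqrt real_sqrt_divide
        diff_divide_distrib)
  have "(norm (diag_powr M (-1/2) ** (diag_powr (diag_part q) (1/2) - diag_powr (diag_part p) (1/2))))\<^sup>2
      = (\<Sum>i\<in>UNIV. \<Sum>j\<in>UNIV. if i = j then ?d i else 0)"
    unfolding norm_matrix_squared D by (intro sum.cong refl) simp
  moreover have "(norm (strict_lower q - strict_lower p))\<^sup>2
      = (\<Sum>i\<in>UNIV. \<Sum>j\<in>UNIV. if j < i then (q $ i $ j - p $ i $ j)\<^sup>2 else 0)"
    unfolding norm_matrix_squared by (intro sum.cong refl) (simp add: strict_lower_def)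
  moreover have "(norm (dbw_coords M q - dbw_coords M p))\<^sup>2
      = (\<Sum>i\<in>UNIV. \<Sum>j\<in>UNIV. if i = j then ?d i else if j < i then (q $ i $ j - p $ i $ j)\<^sup>2 else 0)"
    unfolding norm_matrix_squared by (intro sum.cong refl) (simp add: dbw_coords_def)
  ultimately show ?thesis by (simp add: sum_diag_strict_lower)
qed

text \<open>Solves \<open>sqrt (P / m) = (\<Sum>i\<in>I. w i * sqrt (x i / m))\<close> on the
  diagonal: \<open>m\<close> cancels and squaring gives the formula. That the barycenter has a
  preimage is due to the positive weights.\<close>

lemma frechet_mean_matrix_form:
  fixes w :: "'i \<Rightarrow> real"
  assumes M: "M \<in> pos_diag" and I: "finite I" "I \<noteq> {}"
    and w: "\<And>i. i \<in> I \<Longrightarrow> 0 < w i" and x: "\<And>i. i \<in> I \<Longrightarrow> x i \<in> cholesky"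
  defines "P \<equiv> (\<Sum>i\<in>I. w i *\<^sub>R strict_lower (x i)) +
    mat_square (\<Sum>i\<in>I. w i *\<^sub>R diag_powr (diag_part (x i)) (1/2))"
  shows "P \<in> cholesky" "dbw_coords M P = (\<Sum>i\<in>I. w i *\<^sub>R dbw_coords M (x i))"
proof -
  let ?D = "\<Sum>i\<in>I. w i *\<^sub>R diag_powr (diag_part (x i)) (1/2)"
  let ?s = "\<lambda>a. \<Sum>i\<in>I. w i * sqrt (x i $ a $ a)"
  have D: "?D $ a $ b = (if a = b then ?s a else 0)" for a b
    using choleskyD(1)[OF x]
    by (auto simp: diag_powr_def diag_part_nth powr_half_sqrt less_imp_le intro!: sum.cong)
  have "mat_square ?D $ a $ b = (if a = b then (?D $ a $ a)\<^sup>2 else 0)" for a b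
    by (rule mat_square_diag) (simp add: D del: sum_component)
  then have sq: "mat_square ?D $ a $ b = (if a = b then (?s a)\<^sup>2 else 0)" for a b
    by (simp add: D del: sum_component)
  have P: "P $ a $ b = (if a = b then (?s a)\<^sup>2
      else if b < a then \<Sum>i\<in>I. w i * x i $ a $ b else 0)" for a b
    unfolding P_def vector_add_component sq by (auto simp: strict_lower_def)
  have s: "0 < ?s a" for a
    using I w choleskyD(1)[OF x] by (intro sum_pos) auto
  show "P \<in> cholesky"
    using s[THEN less_imp_neq, symmetric] by (auto simp: cholesky_def lower_tri_def P)
  \<comment> \<open>Positivity of \<open>?s a\<close> makes the root of its square
    \<open>?s a\<close> itself.\<close>
  have "sqrt ((?s a)\<^sup>2 / M $ a $ a) = (\<Sum>i\<in>I. w i * sqrt (x i $ a $ a / M $ a $ a))" for a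
    using s[of a] by (simp add: real_sqrt_divide sum_divide_distrib)
  then show "dbw_coords M P = (\<Sum>i\<in>I. w i *\<^sub>R dbw_coords M (x i))"
    by (auto simp: vec_eq_iff dbw_coords_def P)
qed

text \<open>The domain is a finite intersection of open half-lines or full lines, hence an open
  interval. Any competitor satisfies the positivity condition on its own domain, so it is a
  restriction.\<close>

lemma maximal_geodesic_from_dbw:
  assumes M: "M \<in> pos_diag" and p: "p \<in> cholesky" and v: "v \<in> lower_tri"
  shows "maximal_geodesic_from lower_tri cholesky (dbw_metric M) p v
    {t. diag_part p + (t/2) *\<^sub>R diag_part v \<in> pos_diag} (dbw_geodesic p v)"
proof -
  have T_eq: "{t. diag_part p + (t/2) *\<^sub>R diag_part v \<in> pos_diag} = (\<Inter>i. {t. 0 < p $ i $ i + t / 2 * v $ i $ i})"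
    (is "_ = ?T")
    by (auto simp: pos_diag_def diag_part_nth)
  have "open ?T"
    by (intro open_INT ballI open_Collect_less continuous_intros) auto
  have "is_interval {t. 0 < p $ i $ i + t / 2 * v $ i $ i}" for i
  proof -
    have "{t. 0 < p $ i $ i + t / 2 * v $ i $ i} = {t. (v $ i $ i / 2) \<bullet> t > - p $ i $ i}"
      by (auto simp: algebra_simps)
    then show ?thesis by (simp only: convex_halfspace_gt is_interval_convex_1)
  qed
  then have "is_interval ?T" by (auto simp: is_interval_convex_1 intro!: convex_INT)
  then have "geodesic_from lower_tri cholesky (dbw_metric M) p v ?T (dbw_geodesic p v)"
    using choleskyD(1)[OF p] by (intro geodesic_from_dbw[OF M p v]) auto
  moreover have "U \<subseteq> ?T \<and> (\<forall>t\<in>U. c t = dbw_geodesic p v t)"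
    if U: "open U" and c: "geodesic_from lower_tri cholesky (dbw_metric M) p v U c" for U c
  proof -
    have "0 \<in> U" using c by (simp add: geodesic_from_def)
    \<comment> \<open>Openness of \<open>U\<close> excludes the degenerate domain
      \<open>{0}\<close>, as the uniqueness lemma requires.\<close>
    then have "at 0 within U \<noteq> bot" by (simp add: at_within_open[OF _ U])
    then show ?thesis using geodesic_from_dbw_unique[OF M c] by blast
  qed
  ultimately show ?thesis
    unfolding T_eq maximal_geodesic_from_def using \<open>open ?T\<close> by blast
qed

theorem theorem3p3:
  fixes M L K X Y :: "'n::{finite,linorder} sq_mat"
    and Ls :: "nat \<Rightarrow> 'n sq_mat"
    and w :: "nat \<Rightarrow> real"
    and N :: nat
  assumes "M \<in> pos_diag"
    and "L \<in> cholesky" and "K \<in> cholesky"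
    and "X \<in> lower_tri" and "Y \<in> lower_tri"
    and "\<And>i. i \<in> {1..N} \<Longrightarrow> Ls i \<in> cholesky"
    and "\<And>i. i \<in> {1..N} \<Longrightarrow> 0 < w i"
    and "(\<Sum>i=1..N. w i) = 1"
  shows
    "dbw_metric M L X Y = strict_lower X \<bullet> strict_lower Y +
       1/4 * ((matrix_inv (diag_part L) ** diag_part X) \<bullet> (matrix_inv M ** diag_part Y))
     \<and>
     maximal_geodesic_from lower_tri cholesky (dbw_metric M) L X
       {t. diag_part L + (t/2) *\<^sub>R diag_part X \<in> pos_diag}
       (\<lambda>t. strict_lower L + t *\<^sub>R strict_lower X +
          diag_part L ** mat_square (mat 1 + (t/2) *\<^sub>R (matrix_inv (diag_part L) ** diag_part X)))
     \<and>
     (\<exists>!v. v \<in> exp_domain lower_tri cholesky (dbw_metric M) L \<and>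
           riem_exp lower_tri cholesky (dbw_metric M) L v = K) \<and>
     riem_log lower_tri cholesky (dbw_metric M) L K =
       strict_lower K - strict_lower L +
       2 *\<^sub>R (diag_part L ** (diag_powr (matrix_inv (diag_part L) ** diag_part K) (1/2) - mat 1))
     \<and>
     (\<exists>\<gamma>. geodesic_joining lower_tri cholesky (dbw_metric M) L K \<gamma>) \<and>
     (\<forall>\<gamma>. geodesic_joining lower_tri cholesky (dbw_metric M) L K \<gamma> \<longrightarrow>
        (\<exists>!Z. transports_to lower_tri (dbw_metric M) \<gamma> X Z) \<and>
        parallel_transport lower_tri (dbw_metric M) \<gamma> X =
          strict_lower X +
          diag_powr (matrix_inv (diag_part L) ** diag_part K) (1/2) ** diag_part X)
     \<and>
     (geodesic_dist cholesky (dbw_metric M) L K)\<^sup>2 =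
       (norm (strict_lower K - strict_lower L))\<^sup>2 +
       (norm (diag_powr M (-1/2) **
          (diag_powr (diag_part K) (1/2) - diag_powr (diag_part L) (1/2))))\<^sup>2
     \<and>
     (\<exists>!P. is_frechet_mean cholesky (dbw_metric M) {1..N} w Ls P) \<and>
     frechet_mean cholesky (dbw_metric M) {1..N} w Ls =
       (\<Sum>i=1..N. w i *\<^sub>R strict_lower (Ls i)) +
       mat_square (\<Sum>i=1..N. w i *\<^sub>R diag_powr (diag_part (Ls i)) (1/2))"
proof (intro conjI)
  note M = assms(1) and L = assms(2) and K = assms(3) and X = assms(4)
  let ?g = "dbw_metric M"
  show "dbw_metric M L X Y = strict_lower X \<bullet> strict_lower Y +
      1/4 * ((matrix_inv (diag_part L) ** diag_part X) \<bullet> (matrix_inv M ** diag_part Y))"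
    by (rule dbw_metric_matrix_form[OF M L])
  show "maximal_geodesic_from lower_tri cholesky ?g L X
      {t. diag_part L + (t/2) *\<^sub>R diag_part X \<in> pos_diag}
      (\<lambda>t. strict_lower L + t *\<^sub>R strict_lower X +
        diag_part L ** mat_square (mat 1 + (t/2) *\<^sub>R (matrix_inv (diag_part L) ** diag_part X)))"
    using maximal_geodesic_from_dbw[OF M L X]
    unfolding dbw_geodesic_matrix_form[OF L X, abs_def] .
  \<comment> \<open>An equivalence with one explicit vector settles both unique existence and the
    value of the definite description; the same device is used for transport and mean.\<close>
  have log: "v \<in> exp_domain lower_tri cholesky ?g L \<and> riem_exp lower_tri cholesky ?g L v = K \<longleftrightarrow>
      v = dbw_log L K" for v
    using riem_exp_dbw[OF M] dbw_geodesic_1_eq_iff[OF M L K] dbw_log_exp_domain[OF M L K] by metis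
  show "\<exists>!v. v \<in> exp_domain lower_tri cholesky ?g L \<and> riem_exp lower_tri cholesky ?g L v = K"
    by (simp add: log)
  show "riem_log lower_tri cholesky ?g L K = strict_lower K - strict_lower L +
      2 *\<^sub>R (diag_part L ** (diag_powr (matrix_inv (diag_part L) ** diag_part K) (1/2) - mat 1))"
    unfolding riem_log_def log dbw_log_matrix_form[OF L K] by simp
  show "\<exists>\<gamma>. geodesic_joining lower_tri cholesky ?g L K \<gamma>"
    using geodesic_joining_dbw[OF M L K] by blast
  show "\<forall>\<gamma>. geodesic_joining lower_tri cholesky ?g L K \<gamma> \<longrightarrow>
      (\<exists>!Z. transports_to lower_tri ?g \<gamma> X Z) \<and>
      parallel_transport lower_tri ?g \<gamma> X = strict_lower X +
        diag_powr (matrix_inv (diag_part L) ** diag_part K) (1/2) ** diag_part X"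
    by (simp add: parallel_transport_def transports_to_dbw_iff[OF M _ X]
        dbw_transport_matrix_form[OF L K X])
  show "(geodesic_dist cholesky ?g L K)\<^sup>2 = (norm (strict_lower K - strict_lower L))\<^sup>2 +
      (norm (diag_powr M (-1/2) **
        (diag_powr (diag_part K) (1/2) - diag_powr (diag_part L) (1/2))))\<^sup>2"
    unfolding geodesic_dist_dbw[OF M L K] by (rule norm_dbw_coords_diff_squared[OF M L K])
  let ?P = "(\<Sum>i=1..N. w i *\<^sub>R strict_lower (Ls i)) +
      mat_square (\<Sum>i=1..N. w i *\<^sub>R diag_powr (diag_part (Ls i)) (1/2))"
  \<comment> \<open>An empty family would have total weight 0 instead of 1.\<close>
  have "{1..N} \<noteq> {}" using assms(8) by (metis sum.empty zero_neq_one)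
  then have P: "?P \<in> cholesky" "dbw_coords M ?P = (\<Sum>i=1..N. w i *\<^sub>R dbw_coords M (Ls i))"
    using assms(6,7) by (intro frechet_mean_matrix_form[OF M finite_atLeastAtMost]; blast)+
  have mean: "is_frechet_mean cholesky ?g {1..N} w Ls P \<longleftrightarrow> P = ?P" for P
    by (rule is_frechet_mean_dbw_iff[OF M finite_atLeastAtMost assms(8) assms(6) P])
  show "\<exists>!P. is_frechet_mean cholesky ?g {1..N} w Ls P"
    unfolding mean by simp
  show "frechet_mean cholesky ?g {1..N} w Ls = ?P"
    unfolding frechet_mean_def mean by simp
qed

end
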